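(* Let $k>1$ and $q>2$ be integers and let $\mathbb{K}$ be a number field with $\mathbb{K}\cap\mathbb{Q}(\zeta_q)=\mathbb{Q}$. Let $\widehat{V}_k(q,\mathbb{K})$ be the $\mathbb{K}$-linear span of the numbers $1$ and $\zeta(k,a/q)$ for $1\le a<q$ with $\gcd(a,q)=1$. Then $$\dim_{\mathbb{K}}\widehat{V}_k(q,\mathbb{K})\ \ge\ \frac{\varphi(q)}{2}+1.$$
   Context: For $0<x\le1$ and $\Re(s)>1$, the Hurwitz zeta function is $\zeta(s,x)=\sum_{n\ge0}(n+x)^{-s}$. $\zeta_q=e^{2\pi i/q}$, $\mathbb{Q}(\zeta_q)$ is the $q$-th cyclotomic field, and $\varphi$ is Euler's totient function. Number fields are regarded as subfields of $\mathbb{C}$. *)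

theory Defs
  imports
    "HOL-Analysis.Analysis"
    "HOL-Number_Theory.Totient"
    "HOL-Algebra.Algebraic_Closure_Type"
    "HOL-Algebra.Generated_Fields"
begin

text \<open>Only meant for \<open>Re s > 1\<close> and \<open>0 < x \<le> 1\<close>.  There the series converges, and
  \<open>n + x\<close> is positive, so the complex \<open>powr\<close> is the usual power of a positive real.\<close>

definition hurwitz_zeta :: "complex \<Rightarrow> real \<Rightarrow> complex" where
  "hurwitz_zeta s x = (\<Sum>n. complex_of_real (real n + x) powr (- s))"

abbreviation complex_field :: "complex ring" where
  "complex_field \<equiv> ring_of_type_algebra"

definition number_field :: "complex set \<Rightarrow> bool" where
  "number_field K \<longleftrightarrow> subfield K complex_field \<and> ring.finite_dimension complex_field \<rat> K"

definition cyclotomic_field :: "nat \<Rightarrow> complex set" where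
  "cyclotomic_field q = generate_field complex_field {exp (2 * of_real pi * \<i> / of_nat q)}"

definition V_hat :: "nat \<Rightarrow> nat \<Rightarrow> complex set \<Rightarrow> complex set" where
  "V_hat k q K = ring.Span complex_field K
     (1 # map (\<lambda>a. hurwitz_zeta (of_nat k) (real a / real q)) (filter (\<lambda>a. coprime a q) [1..<q]))"

end

theory Submission
  imports Defs "HOL-Complex_Analysis.Laurent_Convergence" "HOL-Number_Theory.Residues"
    "HOL-Algebra.Finite_Extensions" "Jordan_Normal_Form.Char_Poly"
begin

text \<open>
  For \<open>a\<close> prime to \<open>q\<close> with \<open>2a < q\<close>, the number \<open>\<zeta>(k, a/q) + (-1)\<^sup>k \<zeta>(k, 1 - a/q)\<close> lies in
  \<open>V\<close>, and differentiating the reflection formula of the digamma function shows that it equals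
  \<open>(2 \<pi> i)\<^sup>k g(\<zeta>\<^sub>q\<^sup>a)\<close> for a polynomial \<open>g\<close> over the rationals that does not depend on \<open>a\<close>.
  In a linear relation over \<open>K\<close> between \<open>1\<close> and these \<open>\<phi>(q)/2\<close> numbers, the transcendence of \<open>\<pi>\<close>
  separates the coefficient of \<open>1\<close> from the rest.  What remains is a relation
  \<open>\<Sum> c\<^sub>a g(\<zeta>\<^sub>q\<^sup>a) = 0\<close>; since \<open>K\<close> meets the cyclotomic field in the rationals, the
  cyclotomic polynomial stays irreducible over \<open>K\<close>, so \<open>\<Sum> c\<^sub>a g(\<zeta>\<^sub>q\<^sup>a\<^sup>b) = 0\<close> for all \<open>b\<close>
  prime to \<open>q\<close>.  This is a square linear system whose matrix has one entry at least \<open>1\<close> in each row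
  while the others add up to at most \<open>\<zeta>(k) - 1 < 1\<close>, so all \<open>c\<^sub>a\<close> vanish.

  The transcendence of \<open>\<pi>\<close> comes from the residue theorem for \<open>exp(\<beta> u) / \<Prod>\<^sub>j (u - j/m!)\<^sup>p\<close> with
  \<open>\<beta> = m! \<pi> i\<close>: the sum of the residues is at most \<open>C\<^sup>p / p\<^sup>m\<^sup>p\<close> after scaling, but it is also an
  integer polynomial in an algebraic integer of degree \<open>d\<close> with coefficients of size \<open>(C p)\<^sup>p\<close>.
  It is nonzero modulo \<open>p\<close> because \<open>exp(\<pi> i j) = (-1)\<^sup>j\<close> aligns the signs of the leading
  coefficients, and for \<open>m = 2d\<close> this contradicts the Liouville inequality.
\<close>

hide_const (open) up_ring.monom up_ring.coeff module.smult Polynomials.degree Polynomials.lead_coeff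
  Divisibility.prime Divisibility.irreducible Coset.order Coset.kernel

subsection \<open>Integers generated by an algebraic integer\<close>

lemma abs_det_le:
  fixes A :: "int mat"
  assumes A: "A \<in> carrier_mat n n"
    and B: "\<And>i j. i < n \<Longrightarrow> j < n \<Longrightarrow> real_of_int \<bar>A $$ (i, j)\<bar> \<le> B"
  shows "real_of_int \<bar>Determinant.det A\<bar> \<le> fact n * B ^ n"
proof -
  let ?P = "{p. p permutes {0..<n}}"
  have "\<bar>real_of_int (Determinant.det A)\<bar>
      \<le> (\<Sum>p\<in>?P. \<bar>real_of_int (signof p * (\<Prod>i = 0..<n. A $$ (i, p i)))\<bar>)"
    unfolding det_def'[OF A] of_int_sum by (rule sum_abs)
  also have "\<dots> \<le> (\<Sum>p\<in>?P. B ^ n)"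
  proof (rule sum_mono)
    fix p assume p: "p \<in> ?P"
    have "\<bar>real_of_int (signof p * (\<Prod>i = 0..<n. A $$ (i, p i)))\<bar>
        = (\<Prod>i = 0..<n. real_of_int \<bar>A $$ (i, p i)\<bar>)"
      by (simp add: abs_mult abs_prod sign_def)
    also have "\<dots> \<le> (\<Prod>i = 0..<n. B)"
      using p by (intro prod_mono) (auto simp: permutes_in_image simp flip: of_int_abs intro!: B)
    finally show "\<bar>real_of_int (signof p * (\<Prod>i = 0..<n. A $$ (i, p i)))\<bar> \<le> B ^ n" by simp
  qed
  also have "\<dots> = fact n * B ^ n"
    using card_permutations[of "{0..<n}" n] by simp
  finally show ?thesis by simp
qed

text \<open>Encodes that \<theta> is an algebraic integer of degree \<open>d\<close> with minimal
  polynomial X^d - \<Sum> a_j X^j. The conditions make \<int>[\<theta>] a free \<int>-module on 1,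
  ..., \<theta>^(d-1), and this module structure is what the arguments below rest on.\<close>

locale integral_basis =
  fixes \<theta> :: complex and d :: nat and a :: "nat \<Rightarrow> int"
  assumes d_pos: "d > 0"
    and relation: "\<theta> ^ d = (\<Sum>j<d. of_int (a j) * \<theta> ^ j)"
    and independent: "\<And>c :: nat \<Rightarrow> int. (\<Sum>j<d. of_int (c j) * \<theta> ^ j) = 0 \<Longrightarrow> \<forall>j<d. c j = 0"
begin

text \<open>Coordinates of \<theta>^n in the basis of powers: multiplication by \<theta> shifts them
  by one place, and the overflow \<theta>^d is rewritten by \<open>relation\<close>.\<close>

primrec reduction :: "nat \<Rightarrow> nat \<Rightarrow> int" where
  "reduction 0 j = (if j = 0 then 1 else 0)"
| "reduction (Suc n) j = (if j = 0 then 0 else reduction n (j - 1)) + reduction n (d - 1) * a j"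

text \<open>One multiplication by \<theta> enlarges the largest coordinate at most by this
  factor.\<close>

definition growth :: real where "growth = 1 + (\<Sum>j<d. \<bar>real_of_int (a j)\<bar>)"

lemma growth_ge_1: "growth \<ge> 1"
  by (simp add: growth_def sum_nonneg)

lemma power_eq_reduction: "\<theta> ^ n = (\<Sum>j<d. of_int (reduction n j) * \<theta> ^ j)"
proof (induction n)
  case 0
  have "(\<Sum>j<d. of_int (reduction 0 j) * \<theta> ^ j) = (\<Sum>j<d. if j = 0 then 1 else 0)"
    by (intro sum.cong) auto
  then show ?case using d_pos by simp
next
  case (Suc n)
  obtain e where e: "d = Suc e" using d_pos by (cases d) auto
  have "\<theta> ^ Suc n = (\<Sum>j<d. of_int (reduction n j) * \<theta> ^ Suc j)"
    by (subst power_Suc, subst Suc) (simp add: sum_distrib_left mult_ac)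
  also have "\<dots> = (\<Sum>j<e. of_int (reduction n j) * \<theta> ^ Suc j) + of_int (reduction n e) * \<theta> ^ d"
    by (simp add: e)
  also have "(\<Sum>j<e. of_int (reduction n j) * \<theta> ^ Suc j)
      = (\<Sum>j<d. of_int (if j = 0 then 0 else reduction n (j - 1)) * \<theta> ^ j)"
    unfolding e by (subst sum.lessThan_Suc_shift) simp
  also have "of_int (reduction n e) * \<theta> ^ d = (\<Sum>j<d. of_int (reduction n (d - 1) * a j) * \<theta> ^ j)"
    unfolding relation by (simp only: e sum_distrib_left mult_ac of_int_mult diff_Suc_1)
  finally show ?case by (simp add: sum.distrib[symmetric] ring_distribs)
qed

lemma abs_reduction_le: "j < d \<Longrightarrow> \<bar>real_of_int (reduction n j)\<bar> \<le> growth ^ n"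
proof (induction n arbitrary: j)
  case (Suc n)
  have aj: "\<bar>real_of_int (a j)\<bar> \<le> growth - 1"
    unfolding growth_def using Suc.prems member_le_sum[of j "{..<d}" "\<lambda>j. \<bar>real_of_int (a j)\<bar>"] by simp
  have An: "growth ^ n \<ge> 0" using growth_ge_1 by simp
  have "\<bar>real_of_int (reduction (Suc n) j)\<bar>
      = \<bar>real_of_int (if j = 0 then 0 else reduction n (j - 1)) + real_of_int (reduction n (d - 1)) * real_of_int (a j)\<bar>"
    by simp
  also have "\<dots> \<le> \<bar>real_of_int (if j = 0 then 0 else reduction n (j - 1))\<bar> + \<bar>real_of_int (reduction n (d - 1)) * real_of_int (a j)\<bar>"
    by (rule abs_triangle_ineq)
  also have "\<dots> = \<bar>real_of_int (if j = 0 then 0 else reduction n (j - 1))\<bar> + \<bar>real_of_int (reduction n (d - 1))\<bar> * \<bar>real_of_int (a j)\<bar>"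
    by (simp only: abs_mult)
  also have "\<dots> \<le> growth ^ n + growth ^ n * (growth - 1)"
    using Suc.IH[of "j - 1"] Suc.IH[of "d - 1"] Suc.prems d_pos An aj
    by (intro add_mono mult_mono) auto
  finally show ?case by (simp add: algebra_simps)
qed auto

lemma poly_eq_reduction:
  "poly (of_int_poly P) \<theta> = (\<Sum>j<d. of_int (\<Sum>l\<le>degree P. coeff P l * reduction l j) * \<theta> ^ j)"
proof -
  have "poly (of_int_poly P) \<theta> = (\<Sum>l\<le>degree P. of_int (coeff P l) * \<theta> ^ l)"
    by (simp add: poly_altdef)
  also have "\<dots> = (\<Sum>l\<le>degree P. \<Sum>j<d. of_int (coeff P l * reduction l j) * \<theta> ^ j)"
    by (subst power_eq_reduction) (simp add: sum_distrib_left mult_ac)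
  also have "\<dots> = (\<Sum>j<d. of_int (\<Sum>l\<le>degree P. coeff P l * reduction l j) * \<theta> ^ j)"
    by (subst sum.swap) (simp add: sum_distrib_right)
  finally show ?thesis .
qed

text \<open>Coordinates in \<int>[\<theta>] are unique, and those of the right-hand side are all
  multiples of p; compare the ones at \<theta>^0.\<close>

lemma dvd_if_multiple:
  assumes "of_int n = of_int p * poly (of_int_poly P) \<theta>"
  shows "p dvd n"
proof -
  define z where "z j = (\<Sum>l\<le>degree P. coeff P l * reduction l j)" for j
  have "(\<Sum>j<d. of_int ((if j = 0 then n else 0) - p * z j) * \<theta> ^ j)
      = (\<Sum>j<d. if j = 0 then of_int n else 0) - of_int p * (\<Sum>j<d. of_int (z j) * \<theta> ^ j)"
    unfolding sum_distrib_left sum_subtractf[symmetric] by (intro sum.cong) (auto simp: algebra_simps)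
  also have "\<dots> = 0"
    using assms d_pos unfolding poly_eq_reduction z_def by simp
  finally have "n - p * z 0 = 0"
    using independent d_pos by fastforce
  then show ?thesis by simp
qed

text \<open>The powers of \<open>\<theta>\<close> form an eigenvector of an integer matrix \<open>M\<close> with eigenvalue \<open>P(\<theta>)\<close>;
  the first row of \<open>adj(M) M = det(M)\<close> then bounds the eigenvalue from below.\<close>

lemma liouville:
  obtains C where "C \<ge> 1"
    "\<And>P B n. \<lbrakk>degree P < n; B \<ge> 1; \<And>l. \<bar>real_of_int (coeff P l)\<bar> \<le> B; poly (of_int_poly P) \<theta> \<noteq> 0\<rbrakk>
      \<Longrightarrow> 1 \<le> norm (poly (of_int_poly P) \<theta>) * C ^ n * B ^ (d - 1)"
proof -
  define D where "D = real d * (fact d * (1 + norm \<theta>) ^ d)"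
  define C where "C = D * (2 * growth ^ (1 + d)) ^ (d - 1) "
  have D1: "D \<ge> 1"
  proof -
    have "1 * (1 * 1) \<le> D" unfolding D_def
      using d_pos by (intro mult_mono) (auto simp: fact_ge_1 one_le_power)
    then show ?thesis by simp
  qed
  have A2: "2 * growth ^ (1 + d) \<ge> 1"
    using one_le_power[OF growth_ge_1, of "1 + d"] by linarith
  have C1: "C \<ge> 1" unfolding C_def
    using mult_mono[OF D1 one_le_power[OF A2, of "d - 1"]] D1 by simp
  have "1 \<le> norm (poly (of_int_poly P) \<theta>) * C ^ n * B ^ (d - 1)"
    if deg: "degree P < n" and B1: "B \<ge> 1" and coeffs: "\<And>l. \<bar>real_of_int (coeff P l)\<bar> \<le> B"
      and nz: "poly (of_int_poly P) \<theta> \<noteq> 0" for P B n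
  proof -
    define F where "F = poly (of_int_poly P) \<theta>"
    \<comment> \<open>Row \<open>i\<close> holds the coordinates of P(\<theta>) \<theta>^i, so
      \<open>M\<close> represents multiplication by P(\<theta>).\<close>
    define M :: "int mat" where "M = mat d d (\<lambda>(i, j). \<Sum>l\<le>degree P. coeff P l * reduction (i + l) j)"
    define E where "E = real n * B * growth ^ (n + d)"
    have M: "M \<in> carrier_mat d d" by (simp add: M_def)
    have M_entry: "M $$ (i, j) = (\<Sum>l\<le>degree P. coeff P l * reduction (i + l) j)" if "i < d" "j < d" for i j
      using that by (simp add: M_def)
    have M_mult: "(\<Sum>j<d. of_int (M $$ (i, j)) * \<theta> ^ j) = F * \<theta> ^ i" if "i < d" for i
    proof -
      have "(\<Sum>j<d. of_int (M $$ (i, j)) * \<theta> ^ j)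
          = (\<Sum>j<d. \<Sum>l\<le>degree P. of_int (coeff P l) * (of_int (reduction (i + l) j) * \<theta> ^ j))"
        using that by (intro sum.cong) (auto simp: M_entry sum_distrib_right sum_distrib_left mult_ac)
      also have "\<dots> = (\<Sum>l\<le>degree P. of_int (coeff P l) * \<theta> ^ (i + l))"
        by (subst sum.swap) (simp add: power_eq_reduction[of "_ + _"] sum_distrib_left)
      also have "\<dots> = F * \<theta> ^ i"
        by (simp add: F_def poly_altdef sum_distrib_right sum_distrib_left power_add mult_ac)
      finally show ?thesis .
    qed
    have M_le: "real_of_int \<bar>M $$ (i, j)\<bar> \<le> E" if ij: "i < d" "j < d" for i j
    proof -
      have "real_of_int \<bar>M $$ (i, j)\<bar> = \<bar>\<Sum>l\<le>degree P. real_of_int (coeff P l) * real_of_int (reduction (i + l) j)\<bar>"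
        unfolding M_entry[OF ij] by simp
      also have "\<dots> \<le> (\<Sum>l\<le>degree P. \<bar>real_of_int (coeff P l)\<bar> * \<bar>real_of_int (reduction (i + l) j)\<bar>)"
        unfolding abs_mult[symmetric] by (rule sum_abs)
      also have "\<dots> \<le> (\<Sum>l\<le>degree P. B * growth ^ (n + d))"
      proof (rule sum_mono)
        fix l assume "l \<in> {..degree P}"
        then have "growth ^ (i + l) \<le> growth ^ (n + d)"
          using deg ij growth_ge_1 by (intro power_increasing) auto
        then show "\<bar>real_of_int (coeff P l)\<bar> * \<bar>real_of_int (reduction (i + l) j)\<bar> \<le> B * growth ^ (n + d)"
          using coeffs[of l] abs_reduction_le[OF ij(2), of "i + l"] B1 by (intro mult_mono) auto
      qed
      also have "\<dots> \<le> E"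
        unfolding E_def using deg B1 growth_ge_1 by (simp add: mult_right_mono mult.assoc)
      finally show ?thesis .
    qed
    \<comment> \<open>A vector in the kernel of the transpose gives an element \<Sum> w_i \<theta>^i
      of \<int>[\<theta>] whose product with P(\<theta>) \<noteq> 0 is zero; so this element and all
      w_i vanish.\<close>
    have det_nz: "Determinant.det M \<noteq> 0"
    proof
      assume "Determinant.det M = 0"
      then have "Determinant.det M\<^sup>T = 0" using Determinant.det_transpose[OF M] by simp
      then obtain w where w: "w \<in> carrier_vec d" "w \<noteq> 0\<^sub>v d" "M\<^sup>T *\<^sub>v w = 0\<^sub>v d"
        using det_0_iff_vec_prod_zero[of "M\<^sup>T" d] M by auto
      have col: "(\<Sum>i<d. M $$ (i, j) * w $ i) = 0" if "j < d" for j
      proof -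
        have "(M\<^sup>T *\<^sub>v w) $ j = 0" using w that by simp
        then show ?thesis using that w(1) M by (simp add: scalar_prod_def atLeast0LessThan)
      qed
      have "F * (\<Sum>i<d. of_int (w $ i) * \<theta> ^ i) = (\<Sum>i<d. of_int (w $ i) * (\<Sum>j<d. of_int (M $$ (i, j)) * \<theta> ^ j))"
        by (subst sum_distrib_left, intro sum.cong refl) (simp add: M_mult mult.left_commute)
      also have "\<dots> = (\<Sum>j<d. of_int (\<Sum>i<d. M $$ (i, j) * w $ i) * \<theta> ^ j)"
        unfolding sum_distrib_left of_int_sum sum_distrib_right by (subst sum.swap) (simp add: mult_ac)
      also have "\<dots> = 0" by (simp add: col)
      finally have "\<forall>i<d. w $ i = 0" using independent nz by (simp add: F_def)
      then show False using w(1,2) by (auto simp: vec_eq_iff)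
    qed
    define c where "c k = adj_mat M $$ (0, k)" for k
    have c_le: "real_of_int \<bar>c k\<bar> \<le> fact d * E ^ (d - 1)" if "k < d" for k
    proof -
      have "c k = (-1) ^ (k + 0) * Determinant.det (mat_delete M k 0)"
        unfolding c_def adj_mat_def using that M d_pos by (simp add: cofactor_def)
      then have "real_of_int \<bar>c k\<bar> = real_of_int \<bar>Determinant.det (mat_delete M k 0)\<bar>"
        by (simp add: abs_mult)
      also have "\<dots> \<le> fact (d - 1) * E ^ (d - 1)"
      proof (rule abs_det_le)
        show "mat_delete M k 0 \<in> carrier_mat (d - 1) (d - 1)" using M by (rule mat_delete_carrier)
        fix i j assume "i < d - 1" "j < d - 1"
        then show "real_of_int \<bar>mat_delete M k 0 $$ (i, j)\<bar> \<le> E"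
          using M unfolding mat_delete_def by (auto simp flip: of_int_abs intro!: M_le)
      qed
      also have "\<dots> \<le> fact d * E ^ (d - 1)"
        using B1 growth_ge_1 by (intro mult_right_mono fact_mono) (auto simp: E_def)
      finally show ?thesis .
    qed
    have adj: "(\<Sum>k<d. c k * M $$ (k, j)) = (if j = 0 then Determinant.det M else 0)" if "j < d" for j
    proof -
      have "(adj_mat M * M) $$ (0, j) = (if j = 0 then Determinant.det M else 0)"
        using adj_mat(3)[OF M] that d_pos by simp
      moreover have "(adj_mat M * M) $$ (0, j) = (\<Sum>k<d. c k * M $$ (k, j))"
        using adj_mat(1)[OF M] M that d_pos by (simp add: c_def scalar_prod_def atLeast0LessThan)
      ultimately show ?thesis by simp
    qed
    have "F * (\<Sum>k<d. of_int (c k) * \<theta> ^ k) = (\<Sum>k<d. of_int (c k) * (\<Sum>j<d. of_int (M $$ (k, j)) * \<theta> ^ j))"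
      by (subst sum_distrib_left, intro sum.cong refl) (simp add: M_mult mult.left_commute)
    also have "\<dots> = (\<Sum>j<d. of_int (\<Sum>k<d. c k * M $$ (k, j)) * \<theta> ^ j)"
      unfolding sum_distrib_left of_int_sum sum_distrib_right by (subst sum.swap) (simp add: mult_ac)
    also have "\<dots> = (\<Sum>j<d. if j = 0 then of_int (Determinant.det M) else 0)"
      by (intro sum.cong) (auto simp: adj)
    also have "\<dots> = of_int (Determinant.det M)" using d_pos by simp
    finally have det: "of_int (Determinant.det M) = F * (\<Sum>k<d. of_int (c k) * \<theta> ^ k)" by simp
    have "1 \<le> norm (of_int (Determinant.det M) :: complex)"
      using det_nz by (simp add: norm_of_int)
    also have "\<dots> = norm F * norm (\<Sum>k<d. of_int (c k) * \<theta> ^ k)"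
      unfolding det by (simp add: norm_mult)
    also have "norm (\<Sum>k<d. of_int (c k) * \<theta> ^ k) \<le> (\<Sum>k<d. fact d * E ^ (d - 1) * (1 + norm \<theta>) ^ d)"
    proof (rule sum_norm_le)
      fix k assume k: "k \<in> {..<d}"
      have "norm \<theta> ^ k \<le> (1 + norm \<theta>) ^ k" by (intro power_mono) auto
      also have "\<dots> \<le> (1 + norm \<theta>) ^ d" using k by (intro power_increasing) auto
      finally show "norm (of_int (c k) * \<theta> ^ k) \<le> fact d * E ^ (d - 1) * (1 + norm \<theta>) ^ d"
        unfolding norm_mult norm_power norm_of_int using c_le[of k] k by (intro mult_mono) auto
    qed
    also have "\<dots> = D * E ^ (d - 1)" by (simp add: D_def)
    finally have main: "1 \<le> norm F * (D * E ^ (d - 1))" by (simp add: mult_left_mono)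
    \<comment> \<open>Makes the bound geometric in \<open>n\<close>: the linear factor is absorbed
      by 2^n, and n + d \<le> (1 + d) n because n > degree P \<ge> 0.\<close>
    have "E \<le> (2 * growth ^ (1 + d)) ^ n * B"
    proof -
      have "growth ^ (n + d) \<le> growth ^ ((1 + d) * n)"
        using growth_ge_1 deg by (intro power_increasing) (auto simp: algebra_simps intro!: Suc_leI)
      moreover have "real n \<le> 2 ^ n" using of_nat_less_two_power[of n] by (simp add: less_imp_le)
      ultimately have "real n * growth ^ (n + d) \<le> 2 ^ n * growth ^ ((1 + d) * n)"
        using growth_ge_1 by (intro mult_mono) auto
      then show ?thesis unfolding E_def power_mult_distrib power_mult[symmetric]
        using B1 by (simp add: mult_ac mult_left_mono)
    qed
    then have "E ^ (d - 1) \<le> ((2 * growth ^ (1 + d)) ^ n * B) ^ (d - 1)"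
      using B1 growth_ge_1 by (intro power_mono) (auto simp: E_def)
    also have "\<dots> = ((2 * growth ^ (1 + d)) ^ (d - 1)) ^ n * B ^ (d - 1)"
      by (simp add: power_mult_distrib mult_ac flip: power_mult)
    finally have "D * E ^ (d - 1) \<le> D ^ n * (((2 * growth ^ (1 + d)) ^ (d - 1)) ^ n * B ^ (d - 1))"
      using D1 deg B1 growth_ge_1 by (intro mult_mono) (auto simp: E_def intro: self_le_power)
    also have "\<dots> = C ^ n * B ^ (d - 1)" by (simp add: C_def power_mult_distrib)
    finally have "norm F * (D * E ^ (d - 1)) \<le> norm F * (C ^ n * B ^ (d - 1))"
      by (intro mult_left_mono) auto
    with main show ?thesis by (simp add: F_def mult_ac)
  qed
  with C1 show ?thesis by (rule that)
qed

end

subsection \<open>Transcendence of \<open>\<pi>\<close>\<close>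

definition fps_trunc_norm :: "real \<Rightarrow> nat \<Rightarrow> complex fps \<Rightarrow> real" where
  "fps_trunc_norm r n F = (\<Sum>k<n. norm (fps_nth F k) * r ^ k)"

lemma fps_trunc_norm_nonneg: "r \<ge> 0 \<Longrightarrow> fps_trunc_norm r n F \<ge> 0"
  by (simp add: fps_trunc_norm_def sum_nonneg)

text \<open>The truncated product keeps only index pairs with i + j < n, and these lie in the square
  i, j < n over which the product of the two sums ranges.\<close>

lemma fps_trunc_norm_mult:
  assumes "r \<ge> 0"
  shows "fps_trunc_norm r n (F * G) \<le> fps_trunc_norm r n F * fps_trunc_norm r n G"
proof -
  have "fps_trunc_norm r n (F * G)
      \<le> (\<Sum>k<n. \<Sum>i\<le>k. (norm (fps_nth F i) * r ^ i) * (norm (fps_nth G (k - i)) * r ^ (k - i)))"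
    unfolding fps_trunc_norm_def
  proof (rule sum_mono)
    fix k
    have "norm (fps_nth (F * G) k) * r ^ k \<le> (\<Sum>i\<le>k. norm (fps_nth F i * fps_nth G (k - i))) * r ^ k"
      unfolding fps_mult_nth atMost_atLeast0 using assms by (intro mult_right_mono norm_sum) auto
    also have "\<dots> = (\<Sum>i\<le>k. (norm (fps_nth F i) * r ^ i) * (norm (fps_nth G (k - i)) * r ^ (k - i)))"
      unfolding sum_distrib_right
      by (intro sum.cong refl) (auto simp: norm_mult mult_ac simp flip: power_add)
    finally show "norm (fps_nth (F * G) k) * r ^ k \<le> \<dots>" .
  qed
  also have "\<dots> = (\<Sum>(i, j)\<in>{(i, j). i + j < n}. (norm (fps_nth F i) * r ^ i) * (norm (fps_nth G j) * r ^ j))"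
    by (rule sum.triangle_reindex[symmetric])
  also have "\<dots> \<le> (\<Sum>(i, j)\<in>{..<n} \<times> {..<n}. (norm (fps_nth F i) * r ^ i) * (norm (fps_nth G j) * r ^ j))"
    using assms by (intro sum_mono2) auto
  also have "\<dots> = fps_trunc_norm r n F * fps_trunc_norm r n G"
    by (simp add: fps_trunc_norm_def sum_product sum.cartesian_product)
  finally show ?thesis .
qed

lemma fps_trunc_norm_1: "r \<ge> 0 \<Longrightarrow> fps_trunc_norm r n 1 \<le> 1"
proof -
  have "fps_trunc_norm r n 1 = (\<Sum>k<n. if k = 0 then 1 else 0)"
    unfolding fps_trunc_norm_def by (intro sum.cong) auto
  then show ?thesis by simp
qed

lemma fps_trunc_norm_prod:
  assumes "r \<ge> 0"
  shows "fps_trunc_norm r n (\<Prod>i\<in>I. F i) \<le> (\<Prod>i\<in>I. fps_trunc_norm r n (F i))"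
proof (induction I rule: infinite_finite_induct)
  case (insert x I)
  then show ?case
    using order_trans[OF fps_trunc_norm_mult[OF assms] mult_left_mono[OF insert.IH fps_trunc_norm_nonneg[OF assms]]]
    by simp
qed (use assms in \<open>simp_all add: fps_trunc_norm_1\<close>)

lemma fps_trunc_norm_power:
  assumes "r \<ge> 0"
  shows "fps_trunc_norm r n (F ^ k) \<le> fps_trunc_norm r n F ^ k"
  using fps_trunc_norm_prod[OF assms, of n "\<lambda>_. F" "{..<k}"] by simp

section \<open>Power series with integer coefficients\<close>

lemma fps_nth_prod_0: "fps_nth (\<Prod>i\<in>I. F i) 0 = (\<Prod>i\<in>I. fps_nth (F i :: complex fps) 0)"
  by (induction I rule: infinite_finite_induct) auto

lemma fps_nth_mult_Ints:
  assumes "\<And>n. fps_nth F n \<in> \<int>" "\<And>n. fps_nth G n \<in> (\<int> :: complex set)"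
  shows "fps_nth (F * G) n \<in> \<int>"
  unfolding fps_mult_nth using assms by (intro Ints_sum Ints_mult)

lemma fps_nth_prod_Ints:
  assumes "\<And>i n. i \<in> I \<Longrightarrow> fps_nth (F i) n \<in> (\<int> :: complex set)"
  shows "fps_nth (\<Prod>i\<in>I. F i) n \<in> \<int>"
  using assms
proof (induction I arbitrary: n rule: infinite_finite_induct)
  case (insert x I)
  then show ?case unfolding prod.insert[OF insert.hyps]
    by (intro fps_nth_mult_Ints) auto
qed auto

lemma fps_nth_power_Ints:
  assumes "\<And>n. fps_nth F n \<in> (\<int> :: complex set)"
  shows "fps_nth (F ^ k) n \<in> \<int>"
  using fps_nth_prod_Ints[of "{..<k}" "\<lambda>_. F" n] assms by simp

text \<open>Differentiation shows that n times the n-th coefficient of F^p is p times a coefficient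
  of F' F^(p-1), and p does not divide n.\<close>

lemma fps_nth_power_prime_dvd:
  assumes p: "prime p" and n: "0 < n" "n < p" and F: "\<And>n. fps_nth F n \<in> (\<int> :: complex set)"
  obtains z :: int where "fps_nth (F ^ p) n = of_int (int p * z)"
proof -
  have "fps_nth (F ^ p) n \<in> \<int>" using F by (rule fps_nth_power_Ints)
  then obtain y where y: "fps_nth (F ^ p) n = of_int y" by (auto elim: Ints_cases)
  have "fps_nth (fps_deriv F * F ^ (p - 1)) (n - 1) \<in> \<int>"
    using F by (intro fps_nth_mult_Ints fps_nth_power_Ints) (auto intro!: Ints_mult)
  then obtain w where w: "fps_nth (fps_deriv F * F ^ (p - 1)) (n - 1) = of_int w" by (auto elim: Ints_cases)
  have "of_nat n * fps_nth (F ^ p) n = fps_nth (fps_deriv (F ^ p)) (n - 1)"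
    using n by simp
  also have "\<dots> = of_nat p * of_int w"
    unfolding fps_deriv_power mult.assoc fps_mult_left_const_nth w ..
  finally have "of_int (int n * y) = (of_int (int p * w) :: complex)" by (simp add: y)
  then have eq: "int n * y = int p * w" using of_int_eq_iff by blast
  then have "int p dvd int n * y" by simp
  moreover have "\<not> int p dvd int n" using n by (auto dest: dvd_imp_le)
  ultimately have "int p dvd y" using p prime_dvd_mult_iff[of "int p"] by simp
  then obtain z where "y = int p * z" by (elim dvdE)
  with y show thesis using that[of z] by simp
qed

section \<open>Nodes and expansions at the poles\<close>

definition node :: "nat \<Rightarrow> nat \<Rightarrow> complex" where
  "node m j = of_nat j / fact m"

lemma node_eq_iff [simp]: "node m i = node m j \<longleftrightarrow> i = j"
  by (simp add: node_def)

text \<open>The nodes have denominator \<open>m!\<close> because the reciprocals of their differences are then integers;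
  in particular the division below is exact for \<open>i, j \<le> m\<close>.\<close>

definition node_slope :: "nat \<Rightarrow> nat \<Rightarrow> nat \<Rightarrow> int" where
  "node_slope m j i = fact m div (int j - int i)"

lemma node_slope:
  assumes "i \<le> m" "j \<le> m" "i \<noteq> j"
  shows "of_int (node_slope m j i) = 1 / (node m j - node m i)" "\<bar>node_slope m j i\<bar> \<le> fact m" "node_slope m j i \<noteq> 0"
proof -
  have "nat \<bar>int j - int i\<bar> dvd fact m"
    using assms by (intro dvd_fact) auto
  then have dvd: "(int j - int i) dvd fact m"
    by (metis dvd_abs_iff abs_dvd_iff int_dvd_int_iff nat_0_le abs_ge_zero of_nat_fact)
  then have eq: "node_slope m j i * (int j - int i) = fact m"
    by (simp add: node_slope_def)
  then have "of_int (node_slope m j i) * (of_nat j - of_nat i) = (fact m :: complex)"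
    by (metis of_int_diff of_int_fact of_int_mult of_int_of_nat_eq)
  then show "of_int (node_slope m j i) = 1 / (node m j - node m i)"
    using assms by (simp add: node_def divide_simps)
  show "node_slope m j i \<noteq> 0" using eq by auto
  have "\<bar>node_slope m j i\<bar> * 1 \<le> \<bar>node_slope m j i\<bar> * \<bar>int j - int i\<bar>"
    using assms by (intro mult_left_mono) auto
  also have "\<dots> = fact m" unfolding abs_mult[symmetric] eq by simp
  finally show "\<bar>node_slope m j i\<bar> \<le> fact m" by simp
qed

text \<open>The Taylor expansion, in X = u - \<open>node m j\<close>, of the product of all 1/(u -
  \<open>node m i\<close>) with i \<noteq> j. Its p-th power is the regular part of the rational
  factor in \<open>hermite_kernel\<close>.\<close>

definition pole_cofactor :: "nat \<Rightarrow> nat \<Rightarrow> complex fps" where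
  "pole_cofactor m j = (\<Prod>i\<in>{..m} - {j}. inverse (fps_const (node m j - node m i) + fps_X))"

text \<open>Geometric series: 1/(c + X) = \<Sum> (1/c) (-X/c)^n, where 1/c is the integer
  \<open>node_slope m j i\<close>.\<close>

lemma inverse_linear_nth:
  assumes "i \<le> m" "j \<le> m" "i \<noteq> j"
  shows "fps_nth (inverse (fps_const (node m j - node m i) + fps_X)) n
    = of_int (node_slope m j i * (- node_slope m j i) ^ n)"
proof -
  let ?e = "node_slope m j i" and ?c = "node m j - node m i"
  define H where "H = Abs_fps (\<lambda>n. of_int (?e * (- ?e) ^ n) :: complex)"
  have c: "?c * of_int ?e = 1" using node_slope(1)[OF assms] assms by simp
  have "(fps_const ?c + fps_X) * H = 1"
  proof (rule fps_ext)
    fix n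
    have "fps_nth ((fps_const ?c + fps_X) * H) n
        = ?c * of_int ?e * of_int ((- ?e) ^ n) + (if n = 0 then 0 else of_int (?e * (- ?e) ^ (n - 1)))"
      by (simp add: ring_distribs H_def)
    also have "\<dots> = fps_nth 1 n"
      unfolding c by (cases n) auto
    finally show "fps_nth ((fps_const ?c + fps_X) * H) n = fps_nth 1 n" .
  qed
  then have "inverse (fps_const ?c + fps_X) = H"
    by (metis fps_inverse_unique)
  then show ?thesis by (simp add: H_def)
qed

lemma pole_cofactor_Ints: "j \<le> m \<Longrightarrow> fps_nth (pole_cofactor m j) n \<in> \<int>"
  unfolding pole_cofactor_def by (intro fps_nth_prod_Ints) (auto simp: inverse_linear_nth)

lemma pole_cofactor_nth_0: "j \<le> m \<Longrightarrow> fps_nth (pole_cofactor m j) 0 = of_int (\<Prod>i\<in>{..m} - {j}. node_slope m j i)"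
  unfolding pole_cofactor_def fps_nth_prod_0 of_int_prod
  by (intro prod.cong refl) (subst inverse_linear_nth, auto)

lemma sgn_prod_int: "sgn (\<Prod>i\<in>I. f i :: int) = (\<Prod>i\<in>I. sgn (f i))"
  by (induction I rule: infinite_finite_induct) (auto simp: sgn_mult)

text \<open>Exactly the m - j factors with i > j are negative, and for even m this number has the
  parity of j.\<close>

lemma prod_node_slope_pos:
  assumes "j \<le> m" "even m"
  shows "(-1) ^ j * (\<Prod>i\<in>{..m} - {j}. node_slope m j i) > 0"
proof -
  have sgn_node_slope: "sgn (node_slope m j i) = sgn (int j - int i)" if "i \<le> m" "i \<noteq> j" for i
  proof -
    have "of_int (node_slope m j i) * (of_nat j - of_nat i) = (fact m :: real)"
      using arg_cong[OF node_slope(1)[OF that(1) assms(1) that(2)], of Re] that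
      by (simp add: node_def divide_simps flip: diff_divide_distrib)
    then have "of_int (node_slope m j i * (int j - int i)) > (0 :: real)" by simp
    then have "node_slope m j i * (int j - int i) > 0" by linarith
    then show ?thesis by (auto simp: sgn_if zero_less_mult_iff)
  qed
  have "sgn (\<Prod>i\<in>{..m} - {j}. node_slope m j i) = (\<Prod>i\<in>{..m} - {j}. sgn (int j - int i))"
    unfolding sgn_prod_int by (intro prod.cong) (auto simp: sgn_node_slope)
  also have "\<dots> = (\<Prod>i\<in>{..<j} \<union> {j<..m}. sgn (int j - int i))"
    using assms by (intro prod.cong) auto
  also have "(\<Prod>i\<in>{..<j} \<union> {j<..m}. sgn (int j - int i)) = (\<Prod>i\<in>{..<j}. sgn (int j - int i)) * (\<Prod>i\<in>{j<..m}. sgn (int j - int i))"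
    by (intro prod.union_disjoint) auto
  also have "\<dots> = (-1) ^ (m - j)" by simp
  also have "\<dots> = (-1) ^ j" using assms by (simp add: minus_one_power_iff)
  finally have "sgn ((-1) ^ j * (\<Prod>i\<in>{..m} - {j}. node_slope m j i)) = 1"
    by (simp add: sgn_mult flip: power_add power_mult_distrib)
  then show ?thesis by (simp add: sgn_if split: if_splits)
qed

text \<open>With weight r = 1/(2 m!) each of the m linear factors is majorised by m! times a
  geometric series of ratio 1/2, so it has norm at most 2 m!. Submultiplicativity handles the p-th
  power, and removing the weight r^n costs at most (2 m!)^p.\<close>

lemma pole_cofactor_power_bound:
  assumes "j \<le> m" "n < p"
  shows "norm (fps_nth (pole_cofactor m j ^ p) n) \<le> ((2 * fact m) ^ (m + 1)) ^ p"
proof -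
  define N :: real where "N = fact m"
  have N: "N \<ge> 1" by (simp add: N_def fact_ge_1)
  let ?T = "fps_trunc_norm (1 / (2 * N)) p"
  have factor: "?T (inverse (fps_const (node m j - node m i) + fps_X)) \<le> 2 * N" if "i \<in> {..m} - {j}" for i
  proof -
    have s: "\<bar>real_of_int (node_slope m j i)\<bar> \<le> N"
      using node_slope(2)[of i m j] that assms unfolding N_def
      by (metis Diff_iff atMost_iff insertI1 of_int_abs of_int_fact of_int_le_iff)
    have "?T (inverse (fps_const (node m j - node m i) + fps_X))
        = (\<Sum>k<p. \<bar>real_of_int (node_slope m j i)\<bar> ^ Suc k * (1 / (2 * N)) ^ k)"
      unfolding fps_trunc_norm_def using that assms
      by (intro sum.cong refl, subst inverse_linear_nth)
         (auto simp: norm_mult norm_power abs_mult power_abs)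
    also have "\<dots> \<le> (\<Sum>k<p. N ^ Suc k * (1 / (2 * N)) ^ k)"
      using N s by (intro sum_mono mult_right_mono power_mono) auto
    also have "\<dots> = N * (\<Sum>k<p. (1 / 2) ^ k)"
      unfolding sum_distrib_left using N by (intro sum.cong) (auto simp: power_divide power_mult_distrib)
    also have "\<dots> \<le> N * 2"
      using N sum_le_suminf[OF summable_geometric[of "1/2 :: real"], of "{..<p}"] suminf_geometric[of "1/2 :: real"]
      by (intro mult_left_mono) auto
    finally show ?thesis by simp
  qed
  have "?T (pole_cofactor m j) \<le> (\<Prod>i\<in>{..m} - {j}. ?T (inverse (fps_const (node m j - node m i) + fps_X)))"
    unfolding pole_cofactor_def using N by (intro fps_trunc_norm_prod) auto
  also have "\<dots> \<le> (\<Prod>i\<in>{..m} - {j}. 2 * N)"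
    using N factor by (intro prod_mono) (auto intro!: fps_trunc_norm_nonneg)
  also have "\<dots> = (2 * N) ^ m" using assms by simp
  finally have "?T (pole_cofactor m j ^ p) \<le> ((2 * N) ^ m) ^ p"
    using N by (intro order_trans[OF fps_trunc_norm_power] power_mono fps_trunc_norm_nonneg) auto
  moreover have "norm (fps_nth (pole_cofactor m j ^ p) n) * (1 / (2 * N)) ^ n \<le> ?T (pole_cofactor m j ^ p)"
    unfolding fps_trunc_norm_def using assms N
    by (intro member_le_sum[of n "{..<p}" "\<lambda>k. norm (fps_nth (pole_cofactor m j ^ p) k) * (1 / (2 * N)) ^ k"]) auto
  ultimately have "norm (fps_nth (pole_cofactor m j ^ p) n) * (1 / (2 * N)) ^ n \<le> ((2 * N) ^ m) ^ p" by linarith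
  then have "norm (fps_nth (pole_cofactor m j ^ p) n) \<le> ((2 * N) ^ m) ^ p * (2 * N) ^ n"
    using N by (simp add: field_simps power_divide)
  also have "\<dots> \<le> ((2 * N) ^ m) ^ p * (2 * N) ^ p"
    using N assms by (intro mult_left_mono power_increasing) auto
  finally show ?thesis by (simp add: N_def power_mult_distrib mult_ac)
qed

section \<open>Residues of the Hermite kernel\<close>

definition hermite_kernel :: "nat \<Rightarrow> nat \<Rightarrow> complex \<Rightarrow> complex \<Rightarrow> complex" where
  "hermite_kernel m p \<beta> u = exp (\<beta> * u) / (\<Prod>i\<le>m. u - node m i) ^ p"

text \<open>The pole has order p, so the residue is the coefficient of index p - 1 in the product of
  the exponential series with the regular cofactor. Apart from the exponential in front it is a
  polynomial in \<beta> of degree below p.\<close>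

lemma residue_hermite_kernel:
  assumes "j \<le> m" "p > 0"
  shows "residue (hermite_kernel m p \<beta>) (node m j)
    = exp (\<beta> * node m j) * (\<Sum>l<p. \<beta> ^ l / fact l * fps_nth (pole_cofactor m j ^ p) (p - 1 - l))"
proof -
  obtain p' where p': "p = Suc p'" using assms(2) by (cases p) auto
  define h where "h x = exp (\<beta> * node m j) * (exp (\<beta> * x) *
    (\<Prod>i\<in>{..m} - {j}. inverse ((node m j - node m i) + x)) ^ p)" for x
  have node_diff: "node m j - node m i \<noteq> 0" if "i \<noteq> j" for i
    using that by (simp add: node_def)
  have expansion: "h has_fps_expansion fps_const (exp (\<beta> * node m j)) * (fps_exp \<beta> * pole_cofactor m j ^ p)"
    unfolding h_def pole_cofactor_def
    by (intro fps_expansion_intros) (auto simp: node_diff)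
  have "hermite_kernel m p \<beta> (node m j + x) = h x / x ^ Suc p'" for x
  proof -
    have "(\<Prod>i\<le>m. node m j + x - node m i) = x * (\<Prod>i\<in>{..m} - {j}. node m j - node m i + x)"
      using assms by (subst prod.remove[of _ j]) (auto simp: algebra_simps)
    moreover have "(\<Prod>i\<in>{..m} - {j}. inverse (node m j - node m i + x)) = inverse (\<Prod>i\<in>{..m} - {j}. node m j - node m i + x)"
      using prod_inversef[of "\<lambda>i. node m j - node m i + x" "{..m} - {j}"] by (simp add: o_def)
    moreover have "exp (\<beta> * (node m j + x)) = exp (\<beta> * node m j) * exp (\<beta> * x)"
      by (simp only: ring_distribs exp_add)
    ultimately show ?thesis
      by (simp only: hermite_kernel_def h_def p'[symmetric] power_mult_distrib power_inverse divide_inverse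
          inverse_mult_distrib mult_ac)
  qed
  then have "residue (hermite_kernel m p \<beta>) (node m j) = residue (\<lambda>x. h x / x ^ Suc p') 0"
    by (subst residue_shift_0) simp
  also have "\<dots> = fps_nth (fps_const (exp (\<beta> * node m j)) * (fps_exp \<beta> * pole_cofactor m j ^ p)) p'"
    by (rule residue_fps_expansion_over_power_at_0[OF expansion])
  also have "\<dots> = exp (\<beta> * node m j) * (\<Sum>l<p. \<beta> ^ l / fact l * fps_nth (pole_cofactor m j ^ p) (p - 1 - l))"
    unfolding fps_mult_left_const_nth fps_mult_nth[of "fps_exp \<beta>"]
    by (simp add: p' atLeast0AtMost lessThan_Suc_atMost)
  finally show ?thesis .
qed

text \<open>Residue theorem on the circle of radius p + m about 0: it encloses all nodes, which have
  modulus at most m, and stays at distance at least p from each, so the m + 1 factors of the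
  denominator contribute p^((m+1)p).\<close>

lemma sum_residue_hermite_kernel_bound:
  assumes "p > 0"
  shows "norm (\<Sum>j\<le>m. residue (hermite_kernel m p \<beta>) (node m j))
    \<le> exp (norm \<beta> * (real p + real m)) * (real p + real m) / real p ^ ((m + 1) * p)"
proof -
  define r where "r = real p + real m"
  have r: "r > 0" using assms by (simp add: r_def)
  let ?S = "node m ` {..m}"
  have node_le: "norm (node m i) \<le> real m" if "i \<le> m" for i
  proof -
    have "norm (node m i) = real i / fact m" by (simp add: node_def norm_divide)
    also have "\<dots> \<le> real i" by (simp add: divide_le_eq mult_le_cancel_left1 fact_ge_1)
    finally show ?thesis using that by simp
  qed
  have inj: "inj_on (node m) {..m}" by (auto simp: inj_on_def node_def)
  have holo: "hermite_kernel m p \<beta> holomorphic_on UNIV - ?S"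
    unfolding hermite_kernel_def by (intro holomorphic_intros) auto
  have path: "path_image (circlepath 0 r) \<subseteq> UNIV - ?S"
  proof -
    have "norm z \<noteq> r" if "z \<in> ?S" for z
      using that node_le assms unfolding r_def by force
    then show ?thesis using r by auto
  qed
  have "contour_integral (circlepath 0 r) (hermite_kernel m p \<beta>)
      = 2 * pi * \<i> * (\<Sum>z\<in>?S. winding_number (circlepath 0 r) z * residue (hermite_kernel m p \<beta>) z)"
    by (rule Residue_theorem[OF _ _ _ holo _ _ path]) auto
  also have "(\<Sum>z\<in>?S. winding_number (circlepath 0 r) z * residue (hermite_kernel m p \<beta>) z) = (\<Sum>z\<in>?S. residue (hermite_kernel m p \<beta>) z)"
  proof (intro sum.cong refl)
    fix z assume "z \<in> ?S"
    then have "norm z < r" using node_le assms unfolding r_def by force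
    then show "winding_number (circlepath 0 r) z * residue (hermite_kernel m p \<beta>) z = residue (hermite_kernel m p \<beta>) z"
      using winding_number_circlepath[of z 0 r] by simp
  qed
  also have "\<dots> = (\<Sum>j\<le>m. residue (hermite_kernel m p \<beta>) (node m j))"
    by (simp add: sum.reindex[OF inj])
  finally have int: "contour_integral (circlepath 0 r) (hermite_kernel m p \<beta>)
      = 2 * pi * \<i> * (\<Sum>j\<le>m. residue (hermite_kernel m p \<beta>) (node m j))" .
  have "norm (contour_integral (circlepath 0 r) (hermite_kernel m p \<beta>))
      \<le> exp (norm \<beta> * r) / real p ^ ((m + 1) * p) * (2 * pi * r)"
  proof (rule has_contour_integral_bound_circlepath)
    show "(hermite_kernel m p \<beta> has_contour_integral contour_integral (circlepath 0 r) (hermite_kernel m p \<beta>)) (circlepath 0 r)"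
      using path
      by (intro has_contour_integral_integral contour_integrable_holomorphic_simple[OF holo])
         (auto intro!: open_Diff finite_imp_closed)
    fix u :: complex assume "norm (u - 0) = r"
    then have u: "norm u = r" by simp
    have "norm (exp (\<beta> * u)) \<le> exp (norm \<beta> * r)"
      using norm_exp[of "\<beta> * u"] u by (simp add: norm_mult)
    moreover have "real p ^ ((m + 1) * p) \<le> norm ((\<Prod>i\<le>m. u - node m i) ^ p)"
    proof -
      have "(\<Prod>i\<le>m. real p) \<le> (\<Prod>i\<le>m. norm (u - node m i))"
      proof (intro prod_mono conjI)
        fix i assume "i \<in> {..m}"
        then show "real p \<le> norm (u - node m i)"
          using norm_triangle_ineq2[of u "node m i"] node_le[of i] u by (auto simp: r_def)
      qed auto
      then have "(real p ^ (m + 1)) ^ p \<le> (\<Prod>i\<le>m. norm (u - node m i)) ^ p"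
        by (intro power_mono) auto
      then show ?thesis by (simp only: norm_power power_mult prod_norm)
    qed
    ultimately show "norm (hermite_kernel m p \<beta> u) \<le> exp (norm \<beta> * r) / real p ^ ((m + 1) * p)"
      unfolding hermite_kernel_def norm_divide using assms by (intro frac_le) auto
  qed (use r in auto)
  then have "2 * pi * norm (\<Sum>j\<le>m. residue (hermite_kernel m p \<beta>) (node m j))
      \<le> 2 * pi * (exp (norm \<beta> * r) * r / real p ^ ((m + 1) * p))"
    unfolding int by (simp add: norm_mult mult_ac)
  then show ?thesis
    unfolding r_def by (rule mult_left_le_imp_le) simp
qed

section \<open>Non-vanishing modulo a prime\<close>

context integral_basis
begin

text \<open>Isolating the constant term of \<open>relation\<close> exhibits \<theta> as a divisor of
  a_0 in \<int>[\<theta>]; this takes the place of the norm of \<theta>. The cofactor is nonzero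
  because its coordinate at \<theta>^(d-1) is 1.\<close>

lemma cofactor_poly:
  obtains E :: "int poly" where "\<theta> * poly (of_int_poly E) \<theta> = of_int (a 0)"
    "poly (of_int_poly E) \<theta> \<noteq> 0"
proof -
  obtain e where e: "d = Suc e" using d_pos by (cases d) auto
  define c where "c j = (if j = e then 1 else - a (Suc j))" for j
  define E where "E = (\<Sum>j<d. monom (c j) j)"
  have E: "poly (of_int_poly E) \<theta> = (\<Sum>j<d. of_int (c j) * \<theta> ^ j)"
    by (simp add: E_def hom_distribs poly_sum poly_monom)
  have "\<theta> * poly (of_int_poly E) \<theta> = \<theta> ^ d - (\<Sum>j<e. of_int (a (Suc j)) * \<theta> ^ Suc j)"
    unfolding E e by (simp add: c_def sum_distrib_left ring_distribs sum_negf mult_ac)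
  also have "\<dots> = of_int (a 0)"
    unfolding relation unfolding e sum.lessThan_Suc_shift by simp
  finally have 1: "\<theta> * poly (of_int_poly E) \<theta> = of_int (a 0)" .
  have 2: "poly (of_int_poly E) \<theta> \<noteq> 0"
  proof
    assume "poly (of_int_poly E) \<theta> = 0"
    then have "\<forall>j<d. c j = 0" unfolding E by (rule independent)
    then have "c e = 0" unfolding e by simp
    then show False by (simp add: c_def)
  qed
  from 1 2 show thesis by (rule that)
qed

lemma a_0_nonzero:
  assumes "\<theta> \<noteq> 0"
  shows "a 0 \<noteq> 0"
proof -
  obtain E where "\<theta> * poly (of_int_poly E) \<theta> = of_int (a 0)" "poly (of_int_poly E) \<theta> \<noteq> 0"
    by (rule cofactor_poly)
  then show ?thesis using assms by auto
qed

text \<open>If P(\<theta>) = 0, then the coefficient at index n times \<theta>^n lies in p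
  \<int>[\<theta>]. Multiplying by the n-th power of the cofactor of \<theta> turns \<theta>^n into
  a_0^n, and p would divide an integer prime to it.\<close>

lemma poly_nonzero_mod_prime:
  assumes p: "prime p" "\<not> p dvd a 0"
    and P: "degree P \<le> n" "\<And>l. l < n \<Longrightarrow> p dvd coeff P l" "\<not> p dvd coeff P n"
  shows "poly (of_int_poly P) \<theta> \<noteq> 0"
proof
  assume zero: "poly (of_int_poly P) \<theta> = 0"
  obtain E where E: "\<theta> * poly (of_int_poly E) \<theta> = of_int (a 0)" by (rule cofactor_poly)
  define Q where "Q = (\<Sum>l<n. monom (coeff P l div p) l)"
  have Q: "of_int p * poly (of_int_poly Q) \<theta> = (\<Sum>l<n. of_int (coeff P l) * \<theta> ^ l)"
  proof -
    have "of_int p * poly (of_int_poly Q) \<theta> = (\<Sum>l<n. of_int (p * (coeff P l div p)) * \<theta> ^ l)"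
      by (simp add: Q_def hom_distribs poly_sum poly_monom sum_distrib_left mult_ac)
    also have "\<dots> = (\<Sum>l<n. of_int (coeff P l) * \<theta> ^ l)"
      using P(2) by (intro sum.cong refl) auto
    finally show ?thesis .
  qed
  have "poly (of_int_poly P) \<theta> = (\<Sum>l\<le>n. of_int (coeff P l) * \<theta> ^ l)"
    unfolding poly_altdef using P(1) by (intro sum.mono_neutral_cong_left) (auto simp: coeff_eq_0)
  also have "\<dots> = of_int p * poly (of_int_poly Q) \<theta> + of_int (coeff P n) * \<theta> ^ n"
    unfolding Q by (simp add: lessThan_Suc_atMost[symmetric])
  finally have "of_int (coeff P n) * \<theta> ^ n = of_int p * (- poly (of_int_poly Q) \<theta>)"
    using zero by (simp add: add_eq_0_iff2)
  then have "of_int (coeff P n) * \<theta> ^ n * poly (of_int_poly E) \<theta> ^ n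
      = of_int p * (- poly (of_int_poly Q) \<theta> * poly (of_int_poly E) \<theta> ^ n)"
    by simp
  also have "- poly (of_int_poly Q) \<theta> * poly (of_int_poly E) \<theta> ^ n = poly (of_int_poly (- Q * E ^ n)) \<theta>"
    by (simp add: hom_distribs)
  also have "of_int (coeff P n) * \<theta> ^ n * poly (of_int_poly E) \<theta> ^ n = of_int (coeff P n * a 0 ^ n)"
    using arg_cong[OF E, of "\<lambda>x. x ^ n"] by (simp add: power_mult_distrib mult.assoc)
  finally have "p dvd coeff P n * a 0 ^ n" by (rule dvd_if_multiple)
  then show False using p P(3) by (auto simp: prime_dvd_mult_iff dest: prime_dvd_power)
qed

end

text \<open>Take an integer polynomial of least degree d with root \<alpha> and leading coefficient
  b; then b N \<alpha> is integral of the same degree. The degree must not depend on N, because N =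
  m! is later chosen in terms of d.\<close>

lemma algebraic_integral_basis:
  assumes "algebraic (\<alpha> :: complex)"
  obtains d :: nat and b :: int where "b \<noteq> 0" "d > 0"
    "\<And>N :: int. N \<noteq> 0 \<Longrightarrow> \<exists>a. integral_basis (of_int (b * N) * \<alpha>) d a"
proof -
  let ?P = "\<lambda>f :: int poly. f \<noteq> 0 \<and> poly (of_int_poly f) \<alpha> = 0"
  obtain p where p: "\<forall>i. coeff p i \<in> \<int>" "p \<noteq> 0" "poly p \<alpha> = 0"
    using assms by (auto simp: algebraic_def)
  define g where "g = map_poly (\<lambda>z. \<lfloor>Re z\<rfloor>) p"
  have "of_int_poly g = p"
  proof (rule poly_eqI)
    fix i
    obtain z where "coeff p i = of_int z" using p(1) by (meson Ints_cases)
    then show "coeff (of_int_poly g) i = coeff p i" by (simp add: g_def coeff_map_poly)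
  qed
  then have "?P g" using p by auto
  then obtain f where f: "?P f" "\<And>h. ?P h \<Longrightarrow> degree f \<le> degree h"
    using ex_has_least_nat[of ?P g degree] by blast
  define d where "d = degree f"
  define b where "b = lead_coeff f"
  have b: "b \<noteq> 0" using f by (simp add: b_def)
  have f_sum: "(\<Sum>j<d. of_int (coeff f j) * \<alpha> ^ j) + of_int b * \<alpha> ^ d = 0"
    using f(1) by (simp add: poly_altdef d_def b_def lessThan_Suc_atMost[symmetric])
  have d: "d > 0"
    using f_sum b by (cases "d = 0") auto
  have "\<exists>a. integral_basis (of_int (b * N) * \<alpha>) d a" if N: "N \<noteq> 0" for N :: int
  proof -
    define B where "B = b * N"
    have B: "B \<noteq> 0" using b N by (simp add: B_def)
    \<comment> \<open>Multiplying the equation of \<alpha> by N B^(d-1) makes it monic in B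
      \<alpha>; these are its lower coefficients, moved to the other side.\<close>
    define a where "a j = - coeff f j * N * B ^ (d - 1 - j)" for j
    have "integral_basis (of_int B * \<alpha>) d a"
    proof
      show "d > 0" by fact
      have "(of_int B * \<alpha>) ^ d = of_int (N * B ^ (d - 1)) * (of_int b * \<alpha> ^ d)"
        using d by (cases d) (auto simp: B_def power_mult_distrib)
      also have "of_int b * \<alpha> ^ d = - (\<Sum>j<d. of_int (coeff f j) * \<alpha> ^ j)"
        using f_sum by (simp add: add_eq_0_iff)
      also have "of_int (N * B ^ (d - 1)) * \<dots> = (\<Sum>j<d. of_int (a j) * (of_int B * \<alpha>) ^ j)"
        unfolding mult_minus_right sum_distrib_left sum_negf[symmetric]
      proof (intro sum.cong refl)
        fix j assume "j \<in> {..<d}"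
        then have "B ^ (d - 1) = B ^ (d - 1 - j) * B ^ j" by (simp flip: power_add)
        then show "- (of_int (N * B ^ (d - 1)) * (of_int (coeff f j) * \<alpha> ^ j)) = of_int (a j) * (of_int B * \<alpha>) ^ j"
          by (simp add: a_def power_mult_distrib mult_ac)
      qed
      finally show "(of_int B * \<alpha>) ^ d = (\<Sum>j<d. of_int (a j) * (of_int B * \<alpha>) ^ j)" .
      fix c :: "nat \<Rightarrow> int"
      assume c: "(\<Sum>j<d. of_int (c j) * (of_int B * \<alpha>) ^ j) = 0"
      define h where "h = (\<Sum>j<d. monom (c j * B ^ j) j)"
      have coeff_h: "coeff h j = (if j < d then c j * B ^ j else 0)" for j
        by (simp add: h_def coeff_sum)
      have "poly (of_int_poly h) \<alpha> = 0"
        using c by (simp add: h_def hom_distribs poly_sum poly_monom power_mult_distrib mult_ac)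
      moreover have "degree h < d"
        using d by (intro degree_lessI) (auto simp: coeff_h)
      ultimately have "h = 0" using f(2)[of h] by (auto simp: d_def)
      then have "c j * B ^ j = 0" if "j < d" for j
        using coeff_h[of j] that by simp
      then show "\<forall>j<d. c j = 0" using B by simp
    qed
    then show ?thesis unfolding B_def by blast
  qed
  with b d show thesis by (rule that)
qed

section \<open>The integer form in \<pi> i and the final contradiction\<close>

lemma exp_pi_i_node: "exp (of_int (fact m) * (\<i> * of_real pi) * node m j) = (-1) ^ j"
proof -
  have "of_int (fact m) * (\<i> * of_real pi) * node m j = of_nat j * (\<i> * of_real pi)"
    by (simp add: node_def)
  then show ?thesis by (simp only: exp_of_nat_mult exp_pi_i')
qed

text \<open>The sum of the residues, cleared of its denominators, is an integer polynomial in \<open>\<theta>\<close>; modulo \<open>p\<close>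
  only its leading coefficient survives.\<close>

lemma pi_form:
  fixes m p :: nat and b :: int
  defines "N \<equiv> fact m :: int"
  defines "\<theta> \<equiv> of_int (b * N) * (\<i> * of_real pi) :: complex"
  defines "e \<equiv> \<lambda>j. (-1) ^ j * (\<Prod>i\<in>{..m} - {j}. node_slope m j i)"
  assumes p: "prime p" "odd p" and m: "even m"
  obtains P :: "int poly" where "degree P < p"
    "\<And>l. \<bar>real_of_int (coeff P l)\<bar> \<le> (real p * (1 + \<bar>of_int b\<bar>) * (real m + 1) * (2 * fact m) ^ (m + 1)) ^ p"
    "\<And>l. l < p - 1 \<Longrightarrow> int p dvd coeff P l"
    "coeff P (p - 1) = (\<Sum>j\<le>m. e j ^ p)"
    "poly (of_int_poly P) \<theta> = fact (p - 1) * of_int b ^ (p - 1) *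
        (\<Sum>j\<le>m. residue (hermite_kernel m p (of_int N * (\<i> * of_real pi))) (node m j))"
proof -
  define \<beta> where "\<beta> = of_int N * (\<i> * of_real pi)"
  have \<theta>: "\<theta> = of_int b * \<beta>" by (simp add: \<theta>_def \<beta>_def)
  have p1: "p \<ge> 1" using prime_gt_0_nat[OF p(1)] by simp
  \<comment> \<open>The sign (-1)^j is the value of the exponential at the node, so \<open>c\<close>
    collects the contributions of all poles.\<close>
  define c where "c n = (\<Sum>j\<le>m. (-1) ^ j * fps_nth (pole_cofactor m j ^ p) n)" for n
  have "c n \<in> \<int>" for n
    unfolding c_def by (intro Ints_sum Ints_mult fps_nth_power_Ints pole_cofactor_Ints) auto
  then obtain z where z: "\<And>n. c n = of_int (z n)" by (meson Ints_cases)
  \<comment> \<open>Since \<theta> = b \<beta>, the factor b^(p-1) supplies b^l for \<theta>^l and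
    leaves b^(p-1-l); the factorial (p-1)! clears 1/l!.\<close>
  define F where "F l = (fact (p - 1) div fact l) * b ^ (p - 1 - l) * z (p - 1 - l)" for l
  define P where "P = (\<Sum>l<p. monom (F l) l)"
  have coeff_P: "coeff P l = (if l < p then F l else 0)" for l
    by (simp add: P_def coeff_sum)
  have z_le: "\<bar>real_of_int (z n)\<bar> \<le> (real m + 1) * ((2 * fact m) ^ (m + 1)) ^ p" if "n < p" for n
  proof -
    have "\<bar>real_of_int (z n)\<bar> = norm (c n)" by (simp add: z)
    also have "\<dots> \<le> (\<Sum>j\<le>m. ((2 * fact m) ^ (m + 1)) ^ p)"
      unfolding c_def
    proof (intro sum_norm_le)
      fix j assume "j \<in> {..m}"
      then show "norm ((-1) ^ j * fps_nth (pole_cofactor m j ^ p) n) \<le> ((2 * fact m) ^ (m + 1)) ^ p"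
        using pole_cofactor_power_bound[of j m n p] that by (simp only: norm_mult norm_power norm_minus_cancel norm_one power_one mult_1 atMost_iff)
    qed
    finally show ?thesis by (simp add: add.commute)
  qed
  show thesis
  proof (rule that[of P])
    show "degree P < p" using p1 by (intro degree_lessI) (auto simp: coeff_P)
    show "\<bar>real_of_int (coeff P l)\<bar> \<le> (real p * (1 + \<bar>of_int b\<bar>) * (real m + 1) * (2 * fact m) ^ (m + 1)) ^ p" for l
    proof (cases "l < p")
      case True
      have "(fact (p - 1) div fact l :: int) \<le> fact (p - 1)"
        using zdiv_mono2[of "fact (p - 1)" 1 "fact l"] by (simp add: fact_ge_1)
      then have "real_of_int (fact (p - 1) div fact l) \<le> real_of_int (fact (p - 1))"
        by (simp only: of_int_le_iff)
      also have "\<dots> = fact (p - 1)" by simp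
      also have "\<dots> \<le> real (p ^ p)"
      proof -
        have "fact (p - 1) \<le> (fact p :: real)" by (intro fact_mono) auto
        also have "\<dots> \<le> real (p ^ p)" by (rule fact_le_power)
        finally show ?thesis .
      qed
      finally have 1: "\<bar>real_of_int (fact (p - 1) div fact l)\<bar> \<le> real p ^ p"
        by (simp add: pos_imp_zdiv_nonneg_iff)
      have "\<bar>real_of_int (b ^ (p - 1 - l))\<bar> \<le> (1 + \<bar>of_int b\<bar>) ^ (p - 1 - l)"
        by (simp add: power_abs power_mono)
      also have "\<dots> \<le> (1 + \<bar>of_int b\<bar>) ^ p" by (intro power_increasing) auto
      finally have 2: "\<bar>real_of_int (b ^ (p - 1 - l))\<bar> \<le> (1 + \<bar>of_int b\<bar>) ^ p" .
      have "\<bar>real_of_int (z (p - 1 - l))\<bar> \<le> (real m + 1) * ((2 * fact m) ^ (m + 1)) ^ p"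
        using p1 by (intro z_le) auto
      also have "\<dots> \<le> (real m + 1) ^ p * ((2 * fact m) ^ (m + 1)) ^ p"
        using p1 by (intro mult_right_mono self_le_power) auto
      finally have 3: "\<bar>real_of_int (z (p - 1 - l))\<bar> \<le> \<dots>" .
      have "\<bar>real_of_int (F l)\<bar> \<le> real p ^ p * (1 + \<bar>of_int b\<bar>) ^ p * ((real m + 1) ^ p * ((2 * fact m) ^ (m + 1)) ^ p)"
        unfolding F_def of_int_mult abs_mult using 1 2 3 by (intro mult_mono) auto
      then show ?thesis using True by (simp add: coeff_P power_mult_distrib mult_ac)
    qed (simp add: coeff_P)
    show "int p dvd coeff P l" if "l < p - 1" for l
    proof -
      have n: "0 < p - 1 - l" "p - 1 - l < p" using that by auto
      have "\<exists>y. fps_nth (pole_cofactor m j ^ p) (p - 1 - l) = of_int (int p * y)" if "j \<le> m" for j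
        by (rule fps_nth_power_prime_dvd[OF p(1) n pole_cofactor_Ints[OF that]]) blast
      then obtain y where y: "\<And>j. j \<le> m \<Longrightarrow> fps_nth (pole_cofactor m j ^ p) (p - 1 - l) = of_int (int p * y j)" by metis
      have "of_int (z (p - 1 - l)) = (of_int (int p * (\<Sum>j\<le>m. (-1) ^ j * y j)) :: complex)"
      proof -
        have "c (p - 1 - l) = (\<Sum>j\<le>m. (-1) ^ j * of_int (int p * y j))"
          unfolding c_def by (intro sum.cong refl) (simp only: y atMost_iff)
        then show ?thesis unfolding z[symmetric] by (simp add: sum_distrib_left mult_ac)
      qed
      then have "z (p - 1 - l) = int p * (\<Sum>j\<le>m. (-1) ^ j * y j)" using of_int_eq_iff by blast
      then show ?thesis using that by (simp add: coeff_P F_def)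
    qed
    \<comment> \<open>As p is odd, the sign can be moved into the p-th power that defines
      e_j^p.\<close>
    have sgn_p: "((-1) ^ j) ^ p = ((-1) ^ j :: complex)" for j
      using p(2) by (cases "even j") auto
    have "of_int (z 0) = (\<Sum>j\<le>m. (-1) ^ j * of_int (\<Prod>i\<in>{..m} - {j}. node_slope m j i) ^ p :: complex)"
      unfolding z[symmetric] c_def by (simp add: fps_power_zeroth pole_cofactor_nth_0)
    also have "\<dots> = of_int (\<Sum>j\<le>m. e j ^ p)"
      by (simp add: e_def power_mult_distrib sgn_p)
    finally have "z 0 = (\<Sum>j\<le>m. e j ^ p)" using of_int_eq_iff by blast
    then show "coeff P (p - 1) = (\<Sum>j\<le>m. e j ^ p)" using p1 by (simp add: coeff_P F_def)
    have "(\<Sum>j\<le>m. residue (hermite_kernel m p \<beta>) (node m j))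
        = (\<Sum>j\<le>m. \<Sum>l<p. \<beta> ^ l / fact l * ((-1) ^ j * fps_nth (pole_cofactor m j ^ p) (p - 1 - l)))"
    proof (intro sum.cong refl)
      fix j assume "j \<in> {..m}"
      then have "residue (hermite_kernel m p \<beta>) (node m j)
          = exp (\<beta> * node m j) * (\<Sum>l<p. \<beta> ^ l / fact l * fps_nth (pole_cofactor m j ^ p) (p - 1 - l))"
        using p1 by (intro residue_hermite_kernel) auto
      moreover have "exp (\<beta> * node m j) = (-1) ^ j"
        unfolding \<beta>_def N_def by (rule exp_pi_i_node)
      ultimately show "residue (hermite_kernel m p \<beta>) (node m j)
          = (\<Sum>l<p. \<beta> ^ l / fact l * ((-1) ^ j * fps_nth (pole_cofactor m j ^ p) (p - 1 - l)))"
        by (simp add: sum_distrib_left mult_ac)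
    qed
    also have "\<dots> = (\<Sum>l<p. \<beta> ^ l / fact l * of_int (z (p - 1 - l)))"
      unfolding z[symmetric] c_def sum_distrib_left by (rule sum.swap)
    finally have "fact (p - 1) * of_int b ^ (p - 1) * (\<Sum>j\<le>m. residue (hermite_kernel m p \<beta>) (node m j))
        = (\<Sum>l<p. fact (p - 1) * of_int b ^ (p - 1) * (\<beta> ^ l / fact l * of_int (z (p - 1 - l))))"
      by (simp add: sum_distrib_left)
    also have "\<dots> = (\<Sum>l<p. of_int (F l) * \<theta> ^ l)"
    proof (intro sum.cong refl)
      fix l assume l: "l \<in> {..<p}"
      then have "fact l dvd (fact (p - 1) :: int)" by (intro fact_dvd) auto
      then have 1: "of_int (fact (p - 1) div fact l) = (fact (p - 1) / fact l :: complex)"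
        by (simp add: of_int_div)
      have "of_int b ^ (p - 1) = of_int b ^ (p - 1 - l) * (of_int b ^ l :: complex)"
        using l by (simp flip: power_add)
      then show "fact (p - 1) * of_int b ^ (p - 1) * (\<beta> ^ l / fact l * of_int (z (p - 1 - l))) = of_int (F l) * \<theta> ^ l"
        using 1 by (simp add: F_def \<theta> power_mult_distrib mult_ac)
    qed
    also have "\<dots> = poly (of_int_poly P) \<theta>"
      by (simp add: P_def hom_distribs poly_sum poly_monom)
    finally show "poly (of_int_poly P) \<theta> = fact (p - 1) * of_int b ^ (p - 1) *
        (\<Sum>j\<le>m. residue (hermite_kernel m p (of_int N * (\<i> * of_real pi))) (node m j))"
      by (simp add: \<beta>_def)
  qed
qed

theorem pi_times_i_not_algebraic: "\<not> algebraic (\<i> * of_real pi :: complex)"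
proof
  assume "algebraic (\<i> * of_real pi :: complex)"
  then obtain d :: nat and b :: int where b: "b \<noteq> 0" and d: "d > 0"
    and basis: "\<And>N :: int. N \<noteq> 0 \<Longrightarrow> \<exists>a. integral_basis (of_int (b * N) * (\<i> * of_real pi)) d a"
    by (rule algebraic_integral_basis) blast
  \<comment> \<open>Even, as the signs of \<open>e\<close> require, and at least d: then the decay
    p^(-mp) beats the factor p^((d-1)p) lost in the Liouville inequality.\<close>
  define m where "m = 2 * d"
  define N :: int where "N = fact m"
  define \<theta> where "\<theta> = of_int (b * N) * (\<i> * of_real pi)"
  obtain a where "integral_basis \<theta> d a"
    using basis[of N] unfolding N_def \<theta>_def by auto
  then interpret integral_basis \<theta> d a .
  have \<theta>: "\<theta> \<noteq> 0" using b by (simp add: \<theta>_def N_def)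
  obtain C where C: "C \<ge> 1"
    "\<And>P B n. \<lbrakk>degree P < n; B \<ge> 1; \<And>l. \<bar>real_of_int (coeff P l)\<bar> \<le> B; poly (of_int_poly P) \<theta> \<noteq> 0\<rbrakk>
      \<Longrightarrow> 1 \<le> norm (poly (of_int_poly P) \<theta>) * C ^ n * B ^ (d - 1)"
    by (rule liouville) blast
  define \<beta> where "\<beta> = of_int N * (\<i> * of_real pi)"
  define e where "e j = (-1) ^ j * (\<Prod>i\<in>{..m} - {j}. node_slope m j i)" for j
  define K where "K = (1 + \<bar>real_of_int b\<bar>) * (real m + 1) * (2 * fact m) ^ (m + 1)"
  define H where "H = 2 * (1 + \<bar>real_of_int b\<bar>) * (real m + 1) * exp (norm \<beta> * (real m + 1))"
  have e_pos: "e j > 0" if "j \<le> m" for j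
    unfolding e_def by (rule prod_node_slope_pos[OF that]) (simp add: m_def)
  have K: "K \<ge> 1"
  proof -
    have "1 * 1 * 1 \<le> K" unfolding K_def
      by (intro mult_mono one_le_power) (auto simp: fact_ge_1 intro: order_trans[OF _ mult_mono[of 1 2 1]])
    then show ?thesis by simp
  qed
  have H: "H \<ge> 0" by (simp add: H_def)
  \<comment> \<open>The first three summands make p too large to divide a_0 or the sum of the e_j,
    and too large for the final inequality; the summand 2 makes p odd.\<close>
  obtain p where p: "prime p" "p > nat \<bar>a 0\<bar> + nat (\<Sum>j\<le>m. e j) + nat \<lceil>H * C * K ^ (d - 1)\<rceil> + 2"
    using bigger_prime by blast
  have p_odd: "odd p" using p prime_odd_nat by simp
  have p1: "p \<ge> 1" using p by simp
  have even_m: "even m" by (simp add: m_def)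
  have p_a: "\<not> int p dvd a 0"
  proof
    assume "int p dvd a 0"
    then have "int p \<le> \<bar>a 0\<bar>" using dvd_imp_le_int[OF a_0_nonzero[OF \<theta>], of "int p"] by simp
    then show False using p(2) by linarith
  qed
  obtain P where P: "degree P < p"
    "\<And>l. \<bar>real_of_int (coeff P l)\<bar> \<le> (real p * (1 + \<bar>of_int b\<bar>) * (real m + 1) * (2 * fact m) ^ (m + 1)) ^ p"
    "\<And>l. l < p - 1 \<Longrightarrow> int p dvd coeff P l"
    "coeff P (p - 1) = (\<Sum>j\<le>m. e j ^ p)"
    "poly (of_int_poly P) \<theta> = fact (p - 1) * of_int b ^ (p - 1) * (\<Sum>j\<le>m. residue (hermite_kernel m p \<beta>) (node m j))"
    by (rule pi_form[OF p(1) p_odd even_m, where b = b, folded N_def e_def, folded \<theta>_def \<beta>_def]) (rule that)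
  \<comment> \<open>By Fermat the leading coefficient is congruent to the sum of the e_j, which is
    positive and smaller than p.\<close>
  have p_lead: "\<not> int p dvd coeff P (p - 1)"
  proof
    assume dvd: "int p dvd coeff P (p - 1)"
    have "[e j ^ p = e j] (mod int p)" if "j \<le> m" for j
    proof -
      have "e j \<le> (\<Sum>j\<le>m. e j)" using e_pos that by (intro member_le_sum) (auto intro: less_imp_le)
      then have lt: "nat (e j) < p" using p(2) by linarith
      have "\<not> p dvd nat (e j)" using lt e_pos[OF that] by (auto dest!: dvd_imp_le)
      then have "[nat (e j) ^ (p - 1) = 1] (mod p)" by (rule fermat_theorem[OF p(1)])
      then have "[nat (e j) * nat (e j) ^ (p - 1) = nat (e j) * 1] (mod p)" by (rule cong_scalar_left)
      then have "[nat (e j) ^ p = nat (e j)] (mod p)" using p1 by (cases p) auto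
      then have "[int (nat (e j) ^ p) = int (nat (e j))] (mod int p)" by (simp only: cong_int_iff)
      then show ?thesis using e_pos[OF that] by simp
    qed
    then have "[(\<Sum>j\<le>m. e j ^ p) = (\<Sum>j\<le>m. e j)] (mod int p)" by (intro cong_sum) auto
    from cong_dvd_iff[OF this] have "int p dvd (\<Sum>j\<le>m. e j)" using dvd unfolding P(4) by simp
    moreover have "(\<Sum>j\<le>m. e j) > 0" using e_pos by (intro sum_pos) auto
    ultimately have "int p \<le> (\<Sum>j\<le>m. e j)" by (simp add: zdvd_imp_le)
    then show False using p(2) by linarith
  qed
  have nz: "poly (of_int_poly P) \<theta> \<noteq> 0"
    using p(1) p_a P p_lead p1 by (intro poly_nonzero_mod_prime[of "int p" P "p - 1"]) auto
  have "\<bar>real_of_int (coeff P l)\<bar> \<le> (real p * K) ^ p" for l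
    using P(2)[of l] by (simp add: K_def mult_ac)
  moreover have "(real p * K) ^ p \<ge> 1"
    using mult_mono[of 1 "real p" 1 K] p1 K by (intro one_le_power) auto
  ultimately have lower: "1 \<le> norm (poly (of_int_poly P) \<theta>) * C ^ p * ((real p * K) ^ p) ^ (d - 1)"
    using C(2) P(1) nz by blast
  \<comment> \<open>The factor (p-1)! \<le> p^p cancels one of the m + 1 powers p^p in the
    denominator, hence the exponent m.\<close>
  have upper: "norm (poly (of_int_poly P) \<theta>) \<le> (H / real p ^ m) ^ p"
  proof -
    have "norm (poly (of_int_poly P) \<theta>)
        = fact (p - 1) * \<bar>of_int b\<bar> ^ (p - 1) * norm (\<Sum>j\<le>m. residue (hermite_kernel m p \<beta>) (node m j))"
      unfolding P(5) by (simp add: norm_mult norm_power)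
    also have "\<dots> \<le> real p ^ p * (1 + \<bar>of_int b\<bar>) ^ p *
        ((2 * (real m + 1) * exp (norm \<beta> * (real m + 1))) ^ p / real p ^ ((m + 1) * p))"
    proof (intro mult_mono)
      have "fact (p - 1) \<le> (fact p :: real)" by (intro fact_mono) auto
      also have "\<dots> \<le> real (p ^ p)" by (rule fact_le_power)
      finally show "fact (p - 1) \<le> real p ^ p" by simp
      have "\<bar>real_of_int b\<bar> ^ (p - 1) \<le> (1 + \<bar>real_of_int b\<bar>) ^ (p - 1)" by (intro power_mono) auto
      also have "\<dots> \<le> (1 + \<bar>real_of_int b\<bar>) ^ p" by (intro power_increasing) auto
      finally show "\<bar>real_of_int b\<bar> ^ (p - 1) \<le> (1 + \<bar>real_of_int b\<bar>) ^ p" .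
      have pm: "real p + real m \<le> real p * (real m + 1)"
        using p1 mult_right_mono[of 1 "real p" "real m"] by (simp add: ring_distribs)
      have "norm (\<Sum>j\<le>m. residue (hermite_kernel m p \<beta>) (node m j))
          \<le> exp (norm \<beta> * (real p + real m)) * (real p + real m) / real p ^ ((m + 1) * p)"
        using p1 by (intro sum_residue_hermite_kernel_bound) auto
      also have "\<dots> \<le> (2 * (real m + 1) * exp (norm \<beta> * (real m + 1))) ^ p / real p ^ ((m + 1) * p)"
      proof (rule divide_right_mono)
        have "exp (norm \<beta> * (real p + real m)) \<le> exp (real p * (norm \<beta> * (real m + 1)))"
          using mult_left_mono[OF pm, of "norm \<beta>"] by (simp add: mult_ac)
        also have "\<dots> = exp (norm \<beta> * (real m + 1)) ^ p" by (simp add: exp_of_nat_mult)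
        finally have 1: "exp (norm \<beta> * (real p + real m)) \<le> \<dots>" .
        have "real p \<le> 2 ^ p" using of_nat_less_two_power[of p] by (simp add: less_imp_le)
        moreover have "real m + 1 \<le> (real m + 1) ^ p" using p1 by (intro self_le_power) auto
        ultimately have "real p * (real m + 1) \<le> 2 ^ p * (real m + 1) ^ p" by (intro mult_mono) auto
        with pm have 2: "real p + real m \<le> 2 ^ p * (real m + 1) ^ p" by linarith
        show "exp (norm \<beta> * (real p + real m)) * (real p + real m) \<le> (2 * (real m + 1) * exp (norm \<beta> * (real m + 1))) ^ p"
          using mult_mono[OF 1 2] by (simp only: power_mult_distrib mult_ac) simp
      qed simp
      finally show "norm (\<Sum>j\<le>m. residue (hermite_kernel m p \<beta>) (node m j)) \<le> \<dots>" .
    qed auto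
    also have "\<dots> = (H / real p ^ m) ^ p"
    proof -
      have aux: "x ^ p * B ^ p * ((2 * M * Y) ^ p / x ^ ((m + 1) * p)) = (2 * B * M * Y / x ^ m) ^ p"
        if "x \<noteq> 0" for x B M Y :: real
        using that by (simp add: power_mult_distrib power_divide power_add mult_ac flip: power_mult)
      show ?thesis unfolding H_def by (rule aux) (use p1 in simp)
    qed
    finally show ?thesis .
  qed
  have "1 \<le> norm (poly (of_int_poly P) \<theta>) * (C ^ p * ((real p * K) ^ p) ^ (d - 1))"
    using lower by (simp only: mult.assoc)
  also have "\<dots> \<le> (H / real p ^ m) ^ p * (C ^ p * ((real p * K) ^ p) ^ (d - 1))"
    using C(1) K by (intro mult_right_mono[OF upper]) auto
  also have "\<dots> = (H * C * K ^ (d - 1) * (real p ^ (d - 1) / real p ^ m)) ^ p"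
    by (simp add: power_mult_distrib power_divide mult_ac flip: power_mult)
  finally have ge: "1 \<le> (H * C * K ^ (d - 1) * (real p ^ (d - 1) / real p ^ m)) ^ p" .
  have nonneg: "0 \<le> H * C * K ^ (d - 1) * (real p ^ (d - 1) / real p ^ m)"
    using H C(1) K by simp
  have "1 \<le> H * C * K ^ (d - 1) * (real p ^ (d - 1) / real p ^ m)"
  proof (rule ccontr)
    assume less: "\<not> ?thesis"
    then have "(H * C * K ^ (d - 1) * (real p ^ (d - 1) / real p ^ m)) ^ p
        \<le> (H * C * K ^ (d - 1) * (real p ^ (d - 1) / real p ^ m)) ^ 1"
      using p1 nonneg by (intro power_decreasing) auto
    then show False using ge less by simp
  qed
  also have "\<dots> \<le> H * C * K ^ (d - 1) * (1 / real p)"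
  proof (intro mult_left_mono)
    have "real p ^ (d - 1) * real p = real p ^ d" using d by (cases d) auto
    also have "\<dots> \<le> real p ^ m" using p1 by (intro power_increasing) (auto simp: m_def)
    finally show "real p ^ (d - 1) / real p ^ m \<le> 1 / real p" using p1 by (simp add: divide_simps mult_ac)
  qed (use H C K in auto)
  finally have "real p \<le> H * C * K ^ (d - 1)" using p1 by (simp add: divide_simps)
  then show False using p(2) by linarith
qed

subsection \<open>Conjugation of roots of unity over \<open>K\<close>\<close>

lemma complex_field_simps [simp]:
  "carrier complex_field = UNIV" "mult complex_field = (*)" "add complex_field = (+)"
  "one complex_field = 1" "zero complex_field = 0"
  by (simp_all add: ring_of_type_algebra_def)

lemma complex_field_inverses [simp]:
  "\<ominus>\<^bsub>complex_field\<^esub> x = - x" "x \<noteq> 0 \<Longrightarrow> inv\<^bsub>complex_field\<^esub> x = inverse x"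
proof -
  interpret field complex_field by (rule field_from_type_algebra)
  show "\<ominus>\<^bsub>complex_field\<^esub> x = - x" using minus_equality[of "- x" x] by simp
  show "x \<noteq> 0 \<Longrightarrow> inv\<^bsub>complex_field\<^esub> x = inverse x" by (rule comm_inv_char) auto
qed

lemma subfield_complex_iff:
  "subfield K complex_field \<longleftrightarrow>
    1 \<in> K \<and> (\<forall>x\<in>K. - x \<in> K) \<and> (\<forall>x\<in>K. \<forall>y\<in>K. x + y \<in> K \<and> x * y \<in> K) \<and> (\<forall>x\<in>K. inverse x \<in> K)"
proof -
  interpret field complex_field by (rule field_from_type_algebra)
  show ?thesis
  proof
    assume K: "subfield K complex_field"
    note ring = subringE[OF subfieldE(1)[OF K]]
    have "inverse x \<in> K" if "x \<in> K" for x
      using subfield_m_inv(1)[OF K, of x] that ring by (cases "x = 0") auto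
    with ring show "1 \<in> K \<and> (\<forall>x\<in>K. - x \<in> K) \<and> (\<forall>x\<in>K. \<forall>y\<in>K. x + y \<in> K \<and> x * y \<in> K) \<and> (\<forall>x\<in>K. inverse x \<in> K)"
      by auto
  next
    assume K: "1 \<in> K \<and> (\<forall>x\<in>K. - x \<in> K) \<and> (\<forall>x\<in>K. \<forall>y\<in>K. x + y \<in> K \<and> x * y \<in> K) \<and> (\<forall>x\<in>K. inverse x \<in> K)"
    show "subfield K complex_field"
      using K by (intro subfieldI' subringI) auto
  qed
qed

locale complex_subfield =
  fixes K :: "complex set"
  assumes subfield: "subfield K complex_field"
begin

lemma one_mem [simp]: "1 \<in> K"
  and uminus_mem [simp]: "x \<in> K \<Longrightarrow> - x \<in> K"
  and add_mem [simp]: "x \<in> K \<Longrightarrow> y \<in> K \<Longrightarrow> x + y \<in> K"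
  and mult_mem [simp]: "x \<in> K \<Longrightarrow> y \<in> K \<Longrightarrow> x * y \<in> K"
  and inverse_mem [simp]: "x \<in> K \<Longrightarrow> inverse x \<in> K"
  using subfield unfolding subfield_complex_iff by blast+

lemma zero_mem [simp]: "0 \<in> K"
  using add_mem[OF one_mem uminus_mem[OF one_mem]] by simp

lemma diff_mem [simp]: "x \<in> K \<Longrightarrow> y \<in> K \<Longrightarrow> x - y \<in> K"
  using add_mem[of x "- y"] by simp

lemma divide_mem [simp]: "x \<in> K \<Longrightarrow> y \<in> K \<Longrightarrow> x / y \<in> K"
  by (simp add: divide_inverse)

lemma power_mem [simp]: "x \<in> K \<Longrightarrow> x ^ n \<in> K"
  by (induction n) auto

lemma sum_mem [intro]: "(\<And>i. i \<in> I \<Longrightarrow> f i \<in> K) \<Longrightarrow> sum f I \<in> K"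
  by (induction I rule: infinite_finite_induct) auto

lemma of_nat_mem [simp]: "of_nat n \<in> K"
  by (induction n) auto

lemma of_int_mem [simp]: "of_int n \<in> K"
  by (cases n rule: int_diff_cases) simp

lemma Rats_subset: "\<rat> \<subseteq> K"
  by (auto elim!: Rats_cases' simp: Rats_def) (metis Rats_cases' Rats_of_rat of_int_mem divide_mem)

text \<open>Polynomials over K are kept as a subset of \<complex>[X], so that K, \<rat> and the
  cyclotomic field can be compared without embeddings.\<close>

definition polys :: "complex poly set" where
  "polys = {p. \<forall>i. coeff p i \<in> K}"

lemma polysD: "p \<in> polys \<Longrightarrow> coeff p i \<in> K"
  by (simp add: polys_def)

lemma polys_closed [intro]:
  "0 \<in> polys" "1 \<in> polys" "p \<in> polys \<Longrightarrow> r \<in> polys \<Longrightarrow> p + r \<in> polys"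
  "p \<in> polys \<Longrightarrow> r \<in> polys \<Longrightarrow> p - r \<in> polys" "p \<in> polys \<Longrightarrow> r \<in> polys \<Longrightarrow> p * r \<in> polys"
  "c \<in> K \<Longrightarrow> monom c n \<in> polys" "c \<in> K \<Longrightarrow> p \<in> polys \<Longrightarrow> pCons c p \<in> polys"
  "c \<in> K \<Longrightarrow> p \<in> polys \<Longrightarrow> smult c p \<in> polys" "of_int_poly g \<in> polys"
  by (auto simp: polys_def coeff_mult coeff_pCons coeff_1 split: nat.splits)

lemma polys_sum [intro]: "(\<And>i. i \<in> I \<Longrightarrow> f i \<in> polys) \<Longrightarrow> sum f I \<in> polys"
  by (induction I rule: infinite_finite_induct) auto

text \<open>Long division by the monic f inside K[X]: cancelling the leading term lowers the degree,
  and minimality gives degree f \<le> degree h as long as h \<noteq> 0, so the division can only end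
  in 0.\<close>

lemma minimal_poly_dvd:
  assumes f: "f \<in> polys" "lead_coeff f = 1" "poly f z = 0"
    and min: "\<And>h. h \<in> polys \<Longrightarrow> h \<noteq> 0 \<Longrightarrow> poly h z = 0 \<Longrightarrow> degree f \<le> degree h"
    and h: "h \<in> polys" "poly h z = 0"
  shows "\<exists>g\<in>polys. h = f * g"
  using h
proof (induction "degree h" arbitrary: h rule: less_induct)
  case less
  show ?case
  proof (cases "h = 0")
    case False
    define t where "t = monom (lead_coeff h) (degree h - degree f)"
    define h' where "h' = h - f * t"
    have le: "degree f \<le> degree h" using min less.prems False by simp
    have t: "t \<in> polys" using less.prems by (auto simp: t_def polysD)
    have h': "h' \<in> polys" "poly h' z = 0" using less.prems f t by (auto simp: h'_def)
    have "\<exists>g\<in>polys. h' = f * g"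
    proof (cases "h' = 0")
      case nz: False
      have f0: "f \<noteq> 0" using f(2) by auto
      have t0: "t \<noteq> 0" using False by (simp add: t_def)
      have deg: "degree (f * t) = degree h"
        using f0 t0 le False by (simp add: degree_mult_eq t_def degree_monom_eq)
      moreover have "lead_coeff (f * t) = lead_coeff h"
        using f(2) False by (simp add: lead_coeff_mult t_def degree_monom_eq lead_coeff_monom)
      ultimately have c0: "coeff h' (degree h) = 0" by (simp add: h'_def)
      have "degree h' \<le> degree h"
        unfolding h'_def using deg by (metis degree_diff_le order_refl)
      moreover have "degree h' \<noteq> degree h" using c0 nz by (metis leading_coeff_0_iff)
      ultimately have "degree h' < degree h" by simp
      then show ?thesis using less.hyps h' by blast
    qed (use polys_closed(1) in force)
    then obtain g where "g \<in> polys" "h' = f * g" by blast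
    then have "h = f * (g + t)" by (simp add: h'_def algebra_simps)
    then show ?thesis using \<open>g \<in> polys\<close> t by blast
  qed (use polys_closed(1) in force)
qed

lemma minimal_poly_exists:
  assumes "h \<in> polys" "h \<noteq> 0" "poly h z = 0"
  obtains f where "f \<in> polys" "lead_coeff f = 1" "poly f z = 0" "degree f > 0"
    "\<And>h. h \<in> polys \<Longrightarrow> h \<noteq> 0 \<Longrightarrow> poly h z = 0 \<Longrightarrow> degree f \<le> degree h"
proof -
  let ?P = "\<lambda>h. h \<in> polys \<and> h \<noteq> 0 \<and> poly h z = 0"
  obtain f where f: "?P f" "\<And>h. ?P h \<Longrightarrow> degree f \<le> degree h"
    using ex_has_least_nat[of ?P h degree] assms by blast
  define f' where "f' = Polynomial.smult (inverse (lead_coeff f)) f"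
  have f0: "lead_coeff f \<noteq> 0" using f by simp
  have deg: "degree f' = degree f" using f0 by (simp add: f'_def)
  have f': "f' \<in> polys" "lead_coeff f' = 1" "poly f' z = 0"
    using f f0 by (auto simp: f'_def polysD)
  moreover have "degree f' > 0"
    using f'(2,3) by (metis degree_0_id[of f'] gr0I lead_coeff_pCons(1) poly_const_conv zero_neq_one)
  ultimately show thesis using f(2) deg by (intro that[of f']) auto
qed

end

lemma complex_subfield_Rats: "complex_subfield \<rat>"
  by (rule complex_subfield.intro) (auto simp: subfield_complex_iff)

section \<open>Gauss's lemma for monic rational factors\<close>

lemma rat_poly_clear_denominators:
  assumes "\<And>i. coeff p i \<in> (\<rat> :: complex set)"
  shows "\<exists>A F. A > 0 \<and> of_int_poly F = Polynomial.smult (of_int A) p"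
  using assms
proof (induction p)
  case 0
  show ?case by (intro exI[of _ 1] exI[of _ 0]) auto
next
  case (pCons c p)
  have "\<And>i. coeff p i \<in> \<rat>" using pCons.prems[of "Suc _"] by simp
  then obtain A F where AF: "A > 0" "of_int_poly F = Polynomial.smult (of_int A) p" using pCons.IH by blast
  have "c \<in> \<rat>" using pCons.prems[of 0] by simp
  then obtain a b where ab: "b > 0" "c = of_int a / of_int b" by (auto elim!: Rats_cases')
  have "of_int_poly (pCons (a * A) (Polynomial.smult b F)) = Polynomial.smult (of_int (b * A)) (pCons c p)"
    using ab AF by (simp add: hom_distribs mult.commute)
  then show ?case using ab AF by (intro exI[of _ "b * A"] exI conjI) auto
qed

text \<open>The product g is monic and so has content 1; hence the contents of F = A f and H = B h
  multiply to A B. They divide the leading coefficients A and B, so that of F is A up to a unit, and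
  A divides every coefficient of F.\<close>

lemma gauss_monic:
  fixes f h :: "complex poly" and g :: "int poly"
  assumes f: "\<And>i. coeff f i \<in> \<rat>" "lead_coeff f = 1"
    and h: "\<And>i. coeff h i \<in> \<rat>" "lead_coeff h = 1"
    and fh: "f * h = of_int_poly g"
  shows "\<exists>f'. of_int_poly f' = f"
proof -
  obtain A F where AF: "A > 0" "of_int_poly F = Polynomial.smult (of_int A) f"
    using rat_poly_clear_denominators[OF f(1)] by blast
  obtain B H where BH: "B > 0" "of_int_poly H = Polynomial.smult (of_int B) h"
    using rat_poly_clear_denominators[OF h(1)] by blast
  have lead: "lead_coeff F = A" "lead_coeff H = B"
    using arg_cong[OF AF(2), of lead_coeff] arg_cong[OF BH(2), of lead_coeff] f(2) h(2) AF(1) BH(1) by auto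
  have "of_int_poly (F * H) = (of_int_poly (Polynomial.smult (A * B) g) :: complex poly)"
    by (simp add: hom_distribs AF BH mult.commute flip: fh)
  then have FH: "F * H = Polynomial.smult (A * B) g" by simp
  have "of_int (lead_coeff g) = (1 :: complex)"
    using arg_cong[OF fh, of lead_coeff] f(2) h(2) by (simp add: lead_coeff_mult)
  then have "lead_coeff g = 1" by (simp only: of_int_eq_1_iff)
  then have "Polynomial.content g = 1" by (metis content_dvd_coeff is_unit_content_iff)
  then have prod: "Polynomial.content F * Polynomial.content H = A * B"
    using arg_cong[OF FH, of Polynomial.content] AF BH by (simp add: content_mult abs_mult)
  have cF: "Polynomial.content F dvd A" and cH: "Polynomial.content H dvd B"
    using lead content_dvd_coeff by metis+
  obtain u v where uv: "A = Polynomial.content F * u" "B = Polynomial.content H * v" using cF cH by (auto elim!: dvdE)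
  have "Polynomial.content F * Polynomial.content H \<noteq> 0" using prod AF BH by simp
  then have "u * v = 1" using prod by (simp add: uv)
  then have "is_unit u" by (metis dvd_triv_left)
  then have "A dvd Polynomial.content F" unfolding uv(1) by (simp add: mult_unit_dvd_iff)
  then have dvd: "A dvd coeff F i" for i using content_dvd_coeff dvd_trans by blast
  define f' where "f' = map_poly (\<lambda>c. c div A) F"
  have "of_int_poly f' = f"
  proof (rule poly_eqI)
    fix i
    have "of_int A * coeff f i = of_int (coeff F i)"
      using arg_cong[OF AF(2), of "\<lambda>p. coeff p i"] by simp
    also have "coeff F i = A * (coeff F i div A)" using dvd by simp
    finally show "coeff (of_int_poly f') i = coeff f i"
      using AF(1) by (simp add: f'_def coeff_map_poly del: dvd_mult_div_cancel)
  qed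
  then show ?thesis by blast
qed

section \<open>Frobenius congruence for integer polynomials\<close>

lemma power_add_prime:
  fixes x y :: "'a :: comm_ring_1"
  assumes "prime p"
  shows "\<exists>c. (x + y) ^ p = x ^ p + y ^ p + of_nat p * c"
proof -
  have p: "p > 0" using assms prime_gt_0_nat by blast
  have "(x + y) ^ p = (\<Sum>k\<le>p. of_nat (p choose k) * x ^ k * y ^ (p - k))"
    by (rule binomial_ring)
  also have "\<dots> = x ^ p + (\<Sum>k<p. of_nat (p choose k) * x ^ k * y ^ (p - k))"
    by (simp add: lessThan_Suc_atMost[symmetric])
  also have "{..<p} = insert 0 {0<..<p}" using p by auto
  also have "(\<Sum>k\<in>insert 0 {0<..<p}. of_nat (p choose k) * x ^ k * y ^ (p - k))
      = y ^ p + (\<Sum>k\<in>{0<..<p}. of_nat (p choose k) * x ^ k * y ^ (p - k))"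
    by simp
  also have "(\<Sum>k\<in>{0<..<p}. of_nat (p choose k) * x ^ k * y ^ (p - k))
      = of_nat p * (\<Sum>k\<in>{0<..<p}. of_nat ((p choose k) div p) * x ^ k * y ^ (p - k))"
    unfolding sum_distrib_left
  proof (intro sum.cong refl)
    fix k assume "k \<in> {0<..<p}"
    then have "p dvd p choose k" using assms by (intro dvd_choose_prime) auto
    then have "of_nat (p choose k) = (of_nat p * of_nat ((p choose k) div p) :: 'a)"
      by (metis dvd_mult_div_cancel of_nat_mult)
    then show "of_nat (p choose k) * x ^ k * y ^ (p - k)
        = of_nat p * (of_nat ((p choose k) div p) * x ^ k * y ^ (p - k))"
      by (simp add: mult.assoc)
  qed
  finally show ?thesis by (auto simp: add.assoc)
qed

lemma int_fermat:
  fixes a :: int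
  assumes p: "prime p"
  shows "\<exists>s. a = a ^ p + int p * s"
proof (induction a rule: int_induct[where k = 0])
  case base
  show ?case using prime_gt_0_nat[OF p] by (intro exI[of _ 0]) (simp add: zero_power)
next
  case (step1 a)
  obtain s c where "a = a ^ p + int p * s" "(a + 1) ^ p = a ^ p + 1 ^ p + int p * c"
    using step1.IH power_add_prime[OF p, of a 1] by auto
  then have "a + 1 = (a + 1) ^ p + int p * (s - c)" by (simp add: algebra_simps)
  then show ?case ..
next
  case (step2 a)
  obtain s c where "a = a ^ p + int p * s" "(a - 1 + 1) ^ p = (a - 1) ^ p + 1 ^ p + int p * c"
    using step2.IH power_add_prime[OF p, of "a - 1" 1] by auto
  then have "a - 1 = (a - 1) ^ p + int p * (s + c)" by (simp add: algebra_simps)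
  then show ?case ..
qed

text \<open>Induction on the coefficients: \<open>int_fermat\<close> treats the constant term, and
  \<open>power_add_prime\<close> the sum a + X f.\<close>

lemma int_poly_frobenius:
  fixes f :: "int poly"
  assumes p: "prime p"
  shows "\<exists>r. pcompose f (monom 1 p) = f ^ p + of_nat p * r"
proof (induction f)
  case 0
  show ?case using prime_gt_0_nat[OF p] by (intro exI[of _ 0]) (simp add: zero_power)
next
  case (pCons a f)
  obtain r where r: "pcompose f (monom 1 p) = f ^ p + of_nat p * r" using pCons.IH by blast
  obtain s where s: "a = a ^ p + int p * s" using int_fermat[OF p] by blast
  obtain t where t: "([:a:] + pCons 0 f) ^ p = [:a:] ^ p + pCons 0 f ^ p + of_nat p * t"
    using power_add_prime[OF p] by blast
  have mon: "pCons 0 f = monom 1 1 * f" by (simp add: monom_Suc)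
  have "pcompose (pCons a f) (monom 1 p) = [:a:] + monom 1 p * pcompose f (monom 1 p)"
    by (simp add: pcompose_pCons)
  also have "[:a:] = [:a:] ^ p + of_nat p * [:s:]"
    by (subst s) (simp add: poly_const_pow of_nat_poly)
  also have "monom 1 p * pcompose f (monom 1 p) = pCons 0 f ^ p + of_nat p * (monom 1 p * r)"
    unfolding r mon power_mult_distrib by (simp add: monom_power ring_distribs mult_ac)
  finally have "pcompose (pCons a f) (monom 1 p)
      = ([:a:] + pCons 0 f) ^ p + of_nat p * ([:s:] + monom 1 p * r - t)"
    unfolding t by (simp add: ring_distribs)
  then show ?case by auto
qed

section \<open>Roots of unity and the cyclotomic field\<close>

definition zeta :: "nat \<Rightarrow> complex" where
  "zeta q = exp (2 * of_real pi * \<i> / of_nat q)"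

lemma zeta_power: "zeta q ^ n = exp (2 * of_real pi * \<i> * of_nat n / of_nat q)"
  by (simp add: zeta_def exp_of_nat_mult[symmetric] mult_ac)

lemma zeta_power_eq_1: "q > 0 \<Longrightarrow> zeta q ^ q = 1"
  by (simp add: zeta_power exp_two_pi_i)

lemma root_of_unity_is_zeta_power:
  assumes "q > 0" "z ^ q = 1"
  obtains j where "z = zeta q ^ j"
proof -
  have "z \<in> {z. z ^ q = 1}" using assms by simp
  also have "\<dots> = {exp (2 * of_real pi * \<i> * of_nat j / of_nat q) | j. j < q}"
    using assms by (intro complex_roots_unity) auto
  finally show thesis using that by (auto simp: zeta_power)
qed

lemma complex_subfield_cyclotomic: "complex_subfield (cyclotomic_field q)"
proof -
  interpret field complex_field by (rule field_from_type_algebra)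
  show ?thesis
    unfolding cyclotomic_field_def
    by (intro complex_subfield.intro generate_field_is_subfield) auto
qed

lemma zeta_in_cyclotomic_field: "zeta q \<in> cyclotomic_field q"
  unfolding cyclotomic_field_def zeta_def by (rule generate_field.incl) simp

text \<open>Over \<complex> the monic f is a product of linear factors, and its roots are q-th roots
  of unity, hence powers of \<open>zeta q\<close>.\<close>

lemma monic_factor_over_cyclotomic_field:
  assumes q: "q > 0" and f: "f dvd monom 1 q - 1" "lead_coeff f = 1"
  shows "f \<in> complex_subfield.polys (cyclotomic_field q)"
proof -
  interpret L: complex_subfield "cyclotomic_field q" by (rule complex_subfield_cyclotomic)
  have "f \<noteq> 0" using f(2) by auto
  from alg_closed_imp_factorization[OF this]
  obtain A where "f = Polynomial.smult (lead_coeff f) (\<Prod>x\<in>#A. [:-x, 1:])" by blast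
  then have A: "f = (\<Prod>x\<in>#A. [:-x, 1:])" using f(2) by simp
  have "x \<in> cyclotomic_field q" if "x \<in># A" for x
  proof -
    have fx: "poly f x = 0"
      unfolding A using that by (auto simp: poly_prod_mset)
    obtain k where k: "monom 1 q - 1 = f * k" using f(1) by (elim dvdE)
    have "poly (monom 1 q - 1) x = 0" unfolding k using fx by simp
    then have "x ^ q = 1" by (simp add: poly_monom)
    then obtain j where "x = zeta q ^ j" using root_of_unity_is_zeta_power[OF q] by blast
    then show ?thesis by (simp add: zeta_in_cyclotomic_field)
  qed
  then have "(\<Prod>x\<in>#A. [:-x, 1:]) \<in> L.polys"
  proof (induction A)
    case (add x A)
    then have "[:-x, 1:] * (\<Prod>x\<in>#A. [:-x, 1:]) \<in> L.polys"
      by (intro L.polys_closed L.uminus_mem L.one_mem add.IH) auto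
    then show ?case by (simp only: image_mset_add_mset prod_mset.add_mset)
  qed (simp only: image_mset_empty prod_mset_empty L.polys_closed(2))
  then show ?thesis by (simp flip: A)
qed

text \<open>The minimal polynomial f of \<zeta>_q over K is a monic factor of X^q - 1, so its
  coefficients lie in K and in the cyclotomic field, hence in \<rat>, and by Gauss in \<int>.
  Dedekind's argument shows that the roots of f are stable under p-th powers for every prime p not
  dividing q. As f divides h, roots of f are roots of h.\<close>

theorem cyclotomic_conjugation:
  assumes q: "q > 0" and K: "complex_subfield K" "K \<inter> cyclotomic_field q = \<rat>"
    and h: "\<And>i. coeff h i \<in> K" "poly h (zeta q) = 0" and b: "coprime b q"
  shows "poly h (zeta q ^ b) = 0"
proof -
  interpret K: complex_subfield K by fact
  interpret L: complex_subfield "cyclotomic_field q" by (rule complex_subfield_cyclotomic)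
  interpret Q: complex_subfield \<rat> by (rule complex_subfield_Rats)
  define g :: "int poly" where "g = monom 1 q - 1"
  have g: "of_int_poly g = (monom 1 q - 1 :: complex poly)" by (simp add: g_def hom_distribs)
  have poly_g: "poly (of_int_poly g) z = z ^ q - 1" for z :: complex
    by (simp add: g poly_monom)
  have deg_g: "degree (monom 1 q - 1 :: complex poly) = q"
    using q degree_diff_less[of "monom 1 q :: complex poly"]
    by (intro antisym degree_diff_le le_degree) (auto simp: degree_monom_le)
  have lead_g: "lead_coeff (monom 1 q - 1 :: complex poly) = 1"
    unfolding deg_g using q by simp
  have gK: "monom 1 q - 1 \<in> K.polys" by (intro K.polys_closed K.one_mem)
  have g_zeta: "poly (monom 1 q - 1) (zeta q) = 0" using zeta_power_eq_1[OF q] by (simp add: poly_monom)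
  obtain f where f: "f \<in> K.polys" "lead_coeff f = 1" "poly f (zeta q) = 0" "degree f > 0"
    and min: "\<And>u. u \<in> K.polys \<Longrightarrow> u \<noteq> 0 \<Longrightarrow> poly u (zeta q) = 0 \<Longrightarrow> degree f \<le> degree u"
  proof (rule K.minimal_poly_exists)
    show "monom 1 q - 1 \<in> K.polys" by fact
    show "monom 1 q - 1 \<noteq> (0 :: complex poly)"
    proof
      assume "monom 1 q - 1 = (0 :: complex poly)"
      with lead_g show False by (simp only: coeff_0 zero_neq_one)
    qed
    show "poly (monom 1 q - 1) (zeta q) = 0" by fact
  qed blast
  obtain f2 where f2: "f2 \<in> K.polys" "monom 1 q - 1 = f * f2"
    using K.minimal_poly_dvd[OF f(1-3) min gK g_zeta] by blast
  have lead_f2: "lead_coeff f2 = 1"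
    using lead_g f(2) unfolding f2(2) by (simp add: lead_coeff_mult)
  have rational: "u \<in> Q.polys" if "u \<in> K.polys" "u dvd monom 1 q - 1" "lead_coeff u = 1" for u
  proof -
    have "coeff u i \<in> K \<inter> cyclotomic_field q" for i
      using L.polysD[OF monic_factor_over_cyclotomic_field[OF q that(2,3)]] K.polysD[OF that(1)] by blast
    then show ?thesis unfolding K(2) by (simp add: Q.polys_def)
  qed
  have fQ: "f \<in> Q.polys" and f2Q: "f2 \<in> Q.polys"
    using rational[OF f(1) _ f(2)] rational[OF f2(1) _ lead_f2] unfolding f2(2) by simp_all
  have ff2: "f * f2 = of_int_poly g" by (simp only: g f2(2))
  obtain F where F: "of_int_poly F = f"
    using gauss_monic[OF Q.polysD[OF fQ] f(2) Q.polysD[OF f2Q] lead_f2 ff2] by blast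
  obtain F2 where F2: "of_int_poly F2 = f2"
    using gauss_monic[OF Q.polysD[OF f2Q] lead_f2 Q.polysD[OF fQ] f(2)] ff2 by (metis mult.commute)
  have "of_int_poly g = (of_int_poly (F * F2) :: complex poly)"
    by (simp only: ff2[symmetric] F F2 of_int_poly_hom.hom_mult)
  then have g_eq: "g = F * F2" by simp
  define d where "d = degree f"
  have F_lead: "degree F = d" "coeff F d = 1"
  proof -
    show deg: "degree F = d" unfolding d_def F[symmetric] by simp
    have "of_int (coeff F d) = (1 :: complex)" using f(2) unfolding d_def F[symmetric] by simp
    then show "coeff F d = 1" by (simp only: of_int_eq_1_iff)
  qed
  have minQ: "degree f \<le> degree u" if "u \<in> Q.polys" "u \<noteq> 0" "poly u (zeta q) = 0" for u
    using min[OF _ that(2,3)] that(1) K.Rats_subset by (auto simp: K.polys_def Q.polys_def)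
  \<comment> \<open>f is irreducible over \<rat>, thus minimal for each of its roots: if f = m v
    with m minimal for \<eta>, then \<zeta>_q is a root of m or of v, and v has smaller degree than
    f.\<close>
  have minimal: "degree f \<le> degree u" if \<eta>: "poly f \<eta> = 0" and u: "u \<in> Q.polys" "u \<noteq> 0" "poly u \<eta> = 0" for u \<eta>
  proof -
    obtain m where m: "m \<in> Q.polys" "lead_coeff m = 1" "poly m \<eta> = 0" "degree m > 0"
      and m_min: "\<And>u. u \<in> Q.polys \<Longrightarrow> u \<noteq> 0 \<Longrightarrow> poly u \<eta> = 0 \<Longrightarrow> degree m \<le> degree u"
      using Q.minimal_poly_exists[OF u] by blast
    obtain v where v: "v \<in> Q.polys" "f = m * v"
      using Q.minimal_poly_dvd[OF m(1-3) m_min fQ \<eta>] by blast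
    have nz: "m \<noteq> 0" "v \<noteq> 0" using v f(4) by auto
    have deg: "degree f = degree m + degree v" unfolding v(2) using nz by (rule degree_mult_eq)
    have "poly m (zeta q) = 0 \<or> poly v (zeta q) = 0" using f(3) v by simp
    then have "degree f \<le> degree m"
      using minQ[OF m(1) nz(1)] minQ[OF v(1) nz(2)] deg m(4) by auto
    also have "\<dots> \<le> degree u" by (rule m_min[OF u])
    finally show ?thesis .
  qed
  have root: "\<eta> ^ q = 1" if "poly f \<eta> = 0" for \<eta>
    using that arg_cong[OF f2(2), of "\<lambda>u. poly u \<eta>"] by (simp add: poly_monom)
  \<comment> \<open>Differentiating \<open>X\<^sup>q - 1 = f f2\<close> at \<open>\<eta>\<^sup>p\<close> and using \<open>f(\<eta>\<^sup>p) \<in> p \<int>[\<eta>]\<close> gives \<open>q \<in> p \<int>[\<eta>]\<close>.\<close>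
  have step: "poly f (\<eta> ^ p) = 0" if \<eta>: "poly f \<eta> = 0" and p: "prime p" "\<not> p dvd q" for \<eta> p
  proof (rule ccontr)
    assume nz: "poly f (\<eta> ^ p) \<noteq> 0"
    interpret integral_basis \<eta> d "\<lambda>j. - coeff F j"
    proof
      show "d > 0" using f(4) by (simp add: d_def)
      have "0 = (\<Sum>j\<le>d. of_int (coeff F j) * \<eta> ^ j)"
        using \<eta> unfolding F[symmetric] poly_altdef by (simp add: F_lead(1))
      then show "\<eta> ^ d = (\<Sum>j<d. of_int (- coeff F j) * \<eta> ^ j)"
        by (simp add: lessThan_Suc_atMost[symmetric] F_lead(2) sum_negf add_eq_0_iff)
      fix c :: "nat \<Rightarrow> int"
      assume c: "(\<Sum>j<d. of_int (c j) * \<eta> ^ j) = 0"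
      define u :: "complex poly" where "u = (\<Sum>j<d. monom (of_int (c j)) j)"
      have "poly u \<eta> = 0" using c by (simp add: u_def poly_sum poly_monom)
      moreover have "u \<in> Q.polys" unfolding u_def by (intro Q.polys_sum Q.polys_closed Q.of_int_mem)
      moreover have "degree u < d"
        using f(4) by (intro degree_lessI) (auto simp: u_def coeff_sum d_def)
      ultimately have "u = 0" using minimal[OF \<eta>, of u] by (auto simp: d_def)
      moreover have "coeff u j = (if j < d then of_int (c j) else 0)" for j
        by (simp add: u_def coeff_sum)
      ultimately show "\<forall>j<d. c j = 0" by (metis coeff_0 of_int_eq_0_iff)
    qed
    obtain r where r: "pcompose F (monom 1 p) = F ^ p + of_nat p * r"
      using int_poly_frobenius[OF p(1)] by blast
    have "poly (of_int_poly (pcompose F (monom 1 p))) \<eta> = poly f (\<eta> ^ p)"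
      unfolding F[symmetric] of_int_hom.map_poly_pcompose poly_pcompose by (simp add: poly_monom)
    then have fp: "poly f (\<eta> ^ p) = of_nat p * poly (of_int_poly r) \<eta>"
      unfolding r using \<eta> prime_gt_0_nat[OF p(1)] by (simp add: hom_distribs F zero_power)
    define w where "w = poly (pderiv f2) (\<eta> ^ p)"
    have \<eta>p: "(\<eta> ^ p) ^ q = 1" using root[OF \<eta>] by (metis power_mult mult.commute power_one)
    have "poly f (\<eta> ^ p) * poly f2 (\<eta> ^ p) = 0"
      using arg_cong[OF f2(2), of "\<lambda>u. poly u (\<eta> ^ p)"] \<eta>p by (simp add: poly_monom)
    then have f2p: "poly f2 (\<eta> ^ p) = 0" using nz by simp
    have "of_nat q * (\<eta> ^ p) ^ (q - 1) = poly f (\<eta> ^ p) * w"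
      using arg_cong[OF f2(2), of "\<lambda>u. poly (pderiv u) (\<eta> ^ p)"] f2p
      by (simp add: pderiv_mult pderiv_diff pderiv_monom poly_monom w_def)
    then have "of_nat q * (\<eta> ^ p) ^ q = poly f (\<eta> ^ p) * w * \<eta> ^ p"
      using q by (cases q) (auto simp: mult_ac)
    then have "of_nat q = of_nat p * (poly (of_int_poly r) \<eta> * w * \<eta> ^ p)"
      unfolding fp \<eta>p by (simp add: mult_ac)
    also have "w = poly (of_int_poly (pcompose (pderiv F2) (monom 1 p))) \<eta>"
      unfolding w_def F2[symmetric] of_int_hom.map_poly_pcompose poly_pcompose
      by (simp add: hom_distribs poly_monom)
    also have "poly (of_int_poly r) \<eta> * poly (of_int_poly (pcompose (pderiv F2) (monom 1 p))) \<eta> * \<eta> ^ p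
        = poly (of_int_poly (r * pcompose (pderiv F2) (monom 1 p) * monom 1 p)) \<eta>"
      by (simp add: hom_distribs poly_monom)
    finally have "of_int (int q) = of_int (int p) * poly (of_int_poly (r * pcompose (pderiv F2) (monom 1 p) * monom 1 p)) \<eta>"
      by simp
    then have "int p dvd int q" by (rule dvd_if_multiple)
    then show False using p(2) by simp
  qed
  \<comment> \<open>Split off one prime factor of b at a time; it does not divide q because b is
    coprime to q. The case b = 0 occurs only for q = 1.\<close>
  have "poly f (zeta q ^ b) = 0"
    using b
  proof (induction b rule: less_induct)
    case (less b)
    show ?case
    proof (cases "b = 1")
      case True
      show ?thesis using f(3) unfolding True by simp
    next
      case False
      show ?thesis
      proof (cases "b = 0")
        case True
        then have "q = 1" using less.prems by simp
        then show ?thesis using zeta_power_eq_1[of q] f(3) True by simp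
      next
        case b0: False
        obtain p where p: "prime p" "p dvd b" using False prime_factor_nat by blast
        then obtain c where c: "b = p * c" by (elim dvdE)
        have "c < b" using prime_gt_1_nat[OF p(1)] b0 c by simp
        moreover have cop: "coprime c q" "\<not> p dvd q"
          using less.prems p(1) unfolding c by (auto simp: coprime_absorb_left)
        ultimately have "poly f (zeta q ^ c) = 0" using less.IH by blast
        from step[OF this p(1) cop(2)] show ?thesis by (simp add: c power_mult mult.commute)
      qed
    qed
  qed
  moreover have "h \<in> K.polys" using h(1) by (simp add: K.polys_def)
  then obtain v where "h = f * v"
    using K.minimal_poly_dvd[OF f(1-3) min _ h(2)] by blast
  ultimately show ?thesis by simp
qed

subsection \<open>Reflection formula for Hurwitz zeta values\<close>

text \<open>Both sides are the same series up to the factor (-1)^k (k - 1)! in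
  \<open>Polygamma\<close>, which the right-hand side removes.\<close>

lemma hurwitz_zeta_Polygamma:
  assumes k: "k > 1" and x: "x > 0"
  shows "hurwitz_zeta (of_nat k) x = (-1) ^ k / fact (k - 1) * Polygamma (k - 1) (of_real x)"
proof -
  obtain m where m: "k = Suc m" "m > 0" using k by (cases k) auto
  have "complex_of_real (real n + x) powr (- of_nat k) = inverse ((of_real x + of_nat n) ^ Suc m)" for n
  proof -
    have "complex_of_real (real n + x) \<noteq> 0" using x by (simp only: of_real_eq_0_iff)
    then have "complex_of_real (real n + x) powr (- of_nat k) = inverse (complex_of_real (real n + x) ^ k)"
      by (simp add: powr_minus powr_nat')
    then show ?thesis by (simp add: m add.commute)
  qed
  then have "hurwitz_zeta (of_nat k) x = (\<Sum>n. inverse ((of_real x + of_nat n) ^ Suc m))"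
    by (simp add: hurwitz_zeta_def)
  also have "\<dots> = (-1) ^ k / fact m * ((-1) ^ Suc m * fact m * (\<Sum>n. inverse ((of_real x + of_nat n) ^ Suc m)))"
    by (simp add: m power_mult_distrib[symmetric] flip: power_add mult.assoc)
  also have "\<dots> = (-1) ^ k / fact m * Polygamma m (of_real x)"
    using m by (simp add: Polygamma_def)
  finally show ?thesis by (simp add: m)
qed

section \<open>Cotangent and derivatives of the digamma function\<close>

lemma sin_pi_nonzero: "z \<notin> \<int> \<Longrightarrow> sin (of_real pi * z :: complex) \<noteq> 0"
  by (subst sin_eq_0) (auto simp: field_simps)

lemma exp_2pi_i_neq_1: "z \<notin> \<int> \<Longrightarrow> exp (2 * of_real pi * \<i> * z) \<noteq> (1 :: complex)"
  by (subst exp_eq_1) (auto simp: complex_eq_iff Ints_def complex_is_Int_iff)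

lemma not_nonpos_Int:
  fixes z :: complex
  assumes "z \<notin> \<int>"
  shows "z \<notin> \<int>\<^sub>\<le>\<^sub>0" "1 - z \<notin> \<int>\<^sub>\<le>\<^sub>0"
proof -
  show "z \<notin> \<int>\<^sub>\<le>\<^sub>0" using assms nonpos_Ints_Int by blast
  have "1 - z \<notin> \<int>" using assms Ints_diff[OF Ints_1, of "1 - z"] by auto
  then show "1 - z \<notin> \<int>\<^sub>\<le>\<^sub>0" using nonpos_Ints_Int by blast
qed

text \<open>Logarithmic derivative of \<Gamma>(z) \<Gamma>(1 - z) = \<pi> / sin(\<pi> z).\<close>

lemma Digamma_reflection:
  fixes z :: complex
  assumes z: "z \<notin> \<int>"
  shows "Digamma z - Digamma (1 - z) = - (of_real pi * cos (of_real pi * z) / sin (of_real pi * z))"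
proof -
  note z' = not_nonpos_Int[OF z]
  have s: "sin (of_real pi * z) \<noteq> 0" using z by (rule sin_pi_nonzero)
  have G: "Gamma z \<noteq> 0" "Gamma (1 - z) \<noteq> 0" using z' by (simp_all add: Gamma_eq_zero_iff)
  have "((\<lambda>z. Gamma z * Gamma (1 - z)) has_field_derivative
      Gamma z * Gamma (1 - z) * (Digamma z - Digamma (1 - z))) (at z)"
    using z' by (auto intro!: derivative_eq_intros simp: algebra_simps)
  moreover have "((\<lambda>z. Gamma z * Gamma (1 - z)) has_field_derivative
      - (of_real pi * (of_real pi * cos (of_real pi * z))) / (sin (of_real pi * z) * sin (of_real pi * z))) (at z)"
    unfolding Gamma_reflection_complex using s by (auto intro!: derivative_eq_intros)
  ultimately have "Gamma z * Gamma (1 - z) * (Digamma z - Digamma (1 - z))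
      = - (of_real pi * (of_real pi * cos (of_real pi * z))) / (sin (of_real pi * z) * sin (of_real pi * z))"
    by (rule DERIV_unique)
  then have "of_real pi / sin (of_real pi * z) *
      (Digamma z - Digamma (1 - z) + of_real pi * cos (of_real pi * z) / sin (of_real pi * z)) = 0"
    unfolding Gamma_reflection_complex by (simp add: ring_distribs)
  then have "Digamma z - Digamma (1 - z) + of_real pi * cos (of_real pi * z) / sin (of_real pi * z) = 0"
    using s by simp
  then show ?thesis by (simp only: eq_neg_iff_add_eq_0)
qed

lemma pi_cot_eq:
  fixes z :: complex
  assumes z: "z \<notin> \<int>"
  defines "y \<equiv> exp (2 * of_real pi * \<i> * z)"
  shows "of_real pi * cos (of_real pi * z) / sin (of_real pi * z) = \<i> * of_real pi * (y + 1) / (y - 1)"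
proof -
  define w where "w = exp (\<i> * (of_real pi * z))"
  have w: "w \<noteq> 0" by (simp add: w_def)
  have "2 * of_real pi * \<i> * z = \<i> * (of_real pi * z) + \<i> * (of_real pi * z)" by simp
  then have y: "y = w * w" unfolding y_def w_def exp_add[symmetric] by (rule arg_cong)
  have y1: "y \<noteq> 1" unfolding y_def using z by (rule exp_2pi_i_neq_1)
  have e: "exp (- (\<i> * (of_real pi * z))) = 1 / w" by (simp add: w_def exp_minus divide_inverse)
  have c: "cos (of_real pi * z) = (w + 1 / w) / 2"
    unfolding cos_exp_eq e w_def ..
  have s: "sin (of_real pi * z) = (w - 1 / w) / (2 * \<i>)"
    unfolding sin_exp_eq e w_def ..
  have "w + 1 / w = (y + 1) / w" "w - 1 / w = (y - 1) / w"
    unfolding y using w by (simp_all add: add_divide_distrib diff_divide_distrib)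
  moreover have "p * ((a / w) / 2) / ((b / w) / (2 * \<i>)) = \<i> * p * a / b" if "b \<noteq> 0" for p a b
    using that w by (simp add: field_simps)
  ultimately show ?thesis
    unfolding c s using y1 by simp
qed

text \<open>Numerators N_n of the derivatives of -\<pi> cot(\<pi> z): in y = exp(2 \<pi> i z) the
  n-th derivative is (2 \<pi> i)^(n+1) N_n(y) / (y - 1)^(n+1). As d/dz acts as 2 \<pi> i y d/dy, the
  quotient rule gives the recursion, which starts from -(y + 1)/2.\<close>

primrec cot_poly :: "nat \<Rightarrow> complex poly" where
  "cot_poly 0 = [:-1/2, -1/2:]"
| "cot_poly (Suc n) = monom 1 1 * (pderiv (cot_poly n) * [:-1, 1:] - Polynomial.smult (of_nat (Suc n)) (cot_poly n))"

lemma cot_poly_rational: "coeff (cot_poly n) i \<in> \<rat>"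
proof (induction n arbitrary: i)
  case 0
  have "(-1/2 :: complex) \<in> \<rat>" by (intro Rats_divide Rats_minus_iff[THEN iffD2]) auto
  then show ?case by (auto simp: coeff_pCons split: nat.splits)
next
  case (Suc n)
  then show ?case
    by (auto simp: coeff_monom_mult coeff_pderiv mult_pCons_right coeff_pCons split: nat.splits
        intro!: Rats_diff Rats_add Rats_mult)
qed

text \<open>Differentiate the reflection formula of \<open>Digamma\<close> n times; the inner
  derivative of 1 - z changes the sign at each step.\<close>

lemma Polygamma_reflection:
  fixes z :: complex
  assumes "z \<notin> \<int>"
  shows "Polygamma n z + (-1) ^ Suc n * Polygamma n (1 - z)
    = (2 * of_real pi * \<i>) ^ Suc n * poly (cot_poly n) (exp (2 * of_real pi * \<i> * z))
        / (exp (2 * of_real pi * \<i> * z) - 1) ^ Suc n"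
  using assms
proof (induction n arbitrary: z)
  case 0
  define y where "y = exp (2 * of_real pi * \<i> * z)"
  have "Digamma z - Digamma (1 - z) = - (\<i> * of_real pi * (y + 1) / (y - 1))"
    unfolding Digamma_reflection[OF 0] pi_cot_eq[OF 0] y_def ..
  moreover have "2 * of_real pi * \<i> * poly (cot_poly 0) y = - (\<i> * of_real pi * (y + 1))"
    by (simp add: algebra_simps)
  ultimately show ?case unfolding y_def[symmetric] by simp
next
  case (Suc n)
  let ?c = "2 * of_real pi * \<i> :: complex"
  define y where "y = exp (?c * z)"
  note z' = not_nonpos_Int[OF Suc.prems]
  have y1: "y - 1 \<noteq> 0" using exp_2pi_i_neq_1[OF Suc.prems] by (simp add: y_def)
  have "((\<lambda>z. Polygamma n z + (-1) ^ Suc n * Polygamma n (1 - z)) has_field_derivative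
      Polygamma (Suc n) z + (-1) ^ Suc (Suc n) * Polygamma (Suc n) (1 - z)) (at z)"
    using z' by (auto intro!: derivative_eq_intros)
  \<comment> \<open>The induction hypothesis holds on the whole open complement of \<int>, so its
    right-hand side may be differentiated instead.\<close>
  moreover have "((\<lambda>z. Polygamma n z + (-1) ^ Suc n * Polygamma n (1 - z)) has_field_derivative
      ?c ^ Suc n * ((poly (pderiv (cot_poly n)) y * (?c * y) * (y - 1) ^ Suc n
        - poly (cot_poly n) y * (of_nat (Suc n) * (y - 1) ^ n * (?c * y))) / ((y - 1) ^ Suc n * (y - 1) ^ Suc n))) (at z)"
  proof (rule has_field_derivative_transform_within_open)
    have exp': "((\<lambda>z. exp (?c * z)) has_field_derivative ?c * y) (at z)"
      unfolding y_def by (auto intro!: derivative_eq_intros)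
    have d1: "((\<lambda>z. poly (cot_poly n) (exp (?c * z))) has_field_derivative poly (pderiv (cot_poly n)) y * (?c * y)) (at z)"
      using DERIV_chain2[OF poly_DERIV exp', of "cot_poly n"] by (simp only: y_def)
    have d2: "((\<lambda>z. (exp (?c * z) - 1) ^ Suc n) has_field_derivative of_nat (Suc n) * (y - 1) ^ n * (?c * y)) (at z)"
      using DERIV_power_Suc[OF DERIV_diff[OF exp' DERIV_const[of 1]], of n] by (simp add: y_def mult_ac)
    have nz: "(exp (?c * z) - 1) ^ Suc n \<noteq> 0" using y1 by (simp add: y_def)
    from DERIV_cmult[OF DERIV_divide[OF d1 d2 nz], of "?c ^ Suc n"]
    show "((\<lambda>z. ?c ^ Suc n * (poly (cot_poly n) (exp (?c * z)) / (exp (?c * z) - 1) ^ Suc n)) has_field_derivative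
      ?c ^ Suc n * ((poly (pderiv (cot_poly n)) y * (?c * y) * (y - 1) ^ Suc n
        - poly (cot_poly n) y * (of_nat (Suc n) * (y - 1) ^ n * (?c * y))) / ((y - 1) ^ Suc n * (y - 1) ^ Suc n))) (at z)"
      by (simp only: y_def)
    show "open (- \<int> :: complex set)" by (simp add: open_Compl)
    show "z \<in> - \<int>" using Suc.prems by simp
    show "?c ^ Suc n * (poly (cot_poly n) (exp (?c * w)) / (exp (?c * w) - 1) ^ Suc n)
        = Polygamma n w + (-1) ^ Suc n * Polygamma n (1 - w)" if "w \<in> - \<int>" for w
      using Suc.IH[of w] that by simp
  qed
  ultimately have "Polygamma (Suc n) z + (-1) ^ Suc (Suc n) * Polygamma (Suc n) (1 - z)
      = ?c ^ Suc n * ((poly (pderiv (cot_poly n)) y * (?c * y) * (y - 1) ^ Suc n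
        - poly (cot_poly n) y * (of_nat (Suc n) * (y - 1) ^ n * (?c * y))) / ((y - 1) ^ Suc n * (y - 1) ^ Suc n))"
    by (rule DERIV_unique)
  also have "\<dots> = ?c ^ Suc (Suc n) * poly (cot_poly (Suc n)) y / (y - 1) ^ Suc (Suc n)"
  proof -
    have alg: "c ^ Suc n * ((d * (c * y) * v ^ Suc n - p * (m * v ^ n * (c * y))) / (v ^ Suc n * v ^ Suc n))
        = c ^ Suc (Suc n) * (y * (d * v - m * p)) / v ^ Suc (Suc n)"
      if "v \<noteq> 0" for c d p m v :: complex
    proof -
      have "d * (c * y) * v ^ Suc n - p * (m * v ^ n * (c * y)) = c * (y * (d * v - m * p)) * v ^ n"
        by (simp add: algebra_simps)
      moreover have "v ^ Suc n * v ^ Suc n = v ^ Suc (Suc n) * v ^ n" by simp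
      ultimately show ?thesis using that by simp
    qed
    have "poly (cot_poly (Suc n)) y = y * (poly (pderiv (cot_poly n)) y * (y - 1) - of_nat (Suc n) * poly (cot_poly n) y)"
      unfolding cot_poly.simps by (simp add: poly_monom algebra_simps)
    then show ?thesis by (simp only: alg[OF y1])
  qed
  finally show ?case by (simp only: y_def)
qed

text \<open>At a q-th root of unity y \<noteq> 1 the inner sum (1/q) \<Sum> j y^j equals 1/(y - 1).
  So this is a polynomial form, with rational coefficients and the same for all a, of the reflected
  zeta values divided by (2 \<pi> i)^k.\<close>

definition cot_value_poly :: "nat \<Rightarrow> nat \<Rightarrow> complex poly" where
  "cot_value_poly k q = Polynomial.smult ((-1) ^ k / fact (k - 1))
     (cot_poly (k - 1) * (Polynomial.smult (1 / of_nat q) (\<Sum>j<q. monom (of_nat j) j)) ^ k)"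

lemma cot_value_poly_rational: "coeff (cot_value_poly k q) i \<in> \<rat>"
proof -
  interpret Q: complex_subfield \<rat> by (rule complex_subfield_Rats)
  have pow: "p ^ n \<in> Q.polys" if "p \<in> Q.polys" for p n
    using that by (induction n) (auto intro: Q.polys_closed)
  have "fact n \<in> (\<rat> :: complex set)" for n by (metis Rats_of_nat of_nat_fact)
  then have "cot_value_poly k q \<in> Q.polys"
    unfolding cot_value_poly_def
    by (intro Q.polys_closed Q.polys_sum pow Q.divide_mem Q.power_mem Q.uminus_mem Q.one_mem Q.of_nat_mem)
       (auto simp: Q.polys_def cot_poly_rational)
  then show ?thesis by (rule Q.polysD)
qed

text \<open>Multiplication by y - 1 turns the sum into q y^q minus y times the sum of all powers of
  y, and the latter sum is 0.\<close>

lemma inverse_root_of_unity_minus_1: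
  fixes y :: complex
  assumes "y ^ q = 1" "y \<noteq> 1" "q > 0"
  shows "1 / of_nat q * (\<Sum>j<q. of_nat j * y ^ j) = 1 / (y - 1)"
proof -
  have telescope: "(y - 1) * (\<Sum>j<n. of_nat j * y ^ j) = of_nat n * y ^ n - y * (\<Sum>j<n. y ^ j)" for n
    by (induction n) (auto simp: algebra_simps)
  have "(y - 1) * (\<Sum>j<q. y ^ j) = 0"
    using assms(1) power_diff_1_eq[of y q] by simp
  then have "(\<Sum>j<q. y ^ j) = 0" using assms(2) by simp
  then have "(y - 1) * (\<Sum>j<q. of_nat j * y ^ j) = of_nat q" using telescope[of q] assms(1) by simp
  then show ?thesis using assms(2,3) by (simp add: field_simps)
qed

lemma hurwitz_zeta_reflection:
  assumes k: "k > 1" and a: "0 < a" "a < q"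
  shows "hurwitz_zeta (of_nat k) (real a / real q) + (-1) ^ k * hurwitz_zeta (of_nat k) (real (q - a) / real q)
    = (2 * of_real pi * \<i>) ^ k * poly (cot_value_poly k q) (zeta q ^ a)"
proof -
  define x where "x = real a / real q"
  have x: "0 < x" "x < 1" using a by (auto simp: x_def)
  have x': "real (q - a) / real q = 1 - x" using a by (simp add: x_def of_nat_diff field_simps)
  obtain n where n: "k = Suc n" using k by (cases k) auto
  define y where "y = exp (2 * of_real pi * \<i> * complex_of_real x)"
  have y: "zeta q ^ a = y" by (simp add: zeta_power y_def x_def)
  have nonint: "complex_of_real x \<notin> \<int>"
  proof
    assume "complex_of_real x \<in> \<int>"
    then obtain i where "complex_of_real x = of_int i" by (elim Ints_cases)
    then have "x = of_int i" by (metis of_real_of_int_eq of_real_eq_iff)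
    with x have "0 < i \<and> i < 1" by simp
    then show False by linarith
  qed
  have y1: "y \<noteq> 1" unfolding y_def using nonint by (rule exp_2pi_i_neq_1)
  have yq: "y ^ q = 1"
    unfolding y[symmetric] using a zeta_power_eq_1[of q] by (metis less_trans mult.commute power_mult power_one)
  define h :: "complex poly" where "h = Polynomial.smult (1 / of_nat q) (\<Sum>j<q. monom (of_nat j) j)"
  have inv: "poly h y = 1 / (y - 1)"
    using inverse_root_of_unity_minus_1[OF yq y1] a by (simp add: h_def poly_sum poly_monom)
  have "hurwitz_zeta (of_nat k) x + (-1) ^ k * hurwitz_zeta (of_nat k) (1 - x)
      = (-1) ^ k / fact n * (Polygamma n (of_real x) + (-1) ^ Suc n * Polygamma n (1 - of_real x))"
    using hurwitz_zeta_Polygamma[OF k, of x] hurwitz_zeta_Polygamma[OF k, of "1 - x"] x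
    by (simp add: n algebra_simps)
  also have "\<dots> = (2 * of_real pi * \<i>) ^ k * poly (cot_value_poly k q) y"
    unfolding Polygamma_reflection[OF nonint] cot_value_poly_def h_def[symmetric] poly_smult poly_mult poly_power inv y_def[symmetric]
    by (simp add: n power_divide)
  finally show ?thesis by (simp only: x' y flip: x_def)
qed

subsection \<open>The residue class matrix\<close>

text \<open>For 1 \<le> u \<le> q this is the part of the series \<zeta>(k) over the integers n
  \<ge> 1 congruent to u, that is, q^(-k) \<zeta>(k, u/q).\<close>

definition residue_class_zeta :: "nat \<Rightarrow> nat \<Rightarrow> nat \<Rightarrow> real" where
  "residue_class_zeta k q u = (\<Sum>m. 1 / real (m * q + u) ^ k)"

lemma summable_inverse_power_Suc: "k > 1 \<Longrightarrow> summable (\<lambda>n. 1 / real (n + 1) ^ k)"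
  using summable_Suc_iff[of "\<lambda>n. inverse (real n ^ k)"] inverse_power_summable[of k, where 'a = real]
  by (simp add: inverse_eq_divide)

lemma summable_residue_class_zeta:
  assumes "k > 1" "q > 0" "u > 0"
  shows "summable (\<lambda>m. 1 / real (m * q + u) ^ k)"
proof (rule summable_comparison_test')
  show "summable (\<lambda>n. 1 / real (n + 1) ^ k)" using assms(1) by (rule summable_inverse_power_Suc)
  show "norm (1 / real (m * q + u) ^ k) \<le> 1 / real (m + 1) ^ k" if "0 \<le> m" for m
  proof -
    have "m + 1 \<le> m * q + u" using assms(2,3) by (intro add_mono) auto
    then have "real (m + 1) \<le> real (m * q + u)" by (simp only: of_nat_le_iff)
    then have "real (m + 1) ^ k \<le> real (m * q + u) ^ k" by (intro power_mono) auto
    then show ?thesis by (simp add: frac_le)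
  qed
qed

lemma residue_class_zeta_nonneg: "k > 1 \<Longrightarrow> q > 0 \<Longrightarrow> u > 0 \<Longrightarrow> residue_class_zeta k q u \<ge> 0"
  unfolding residue_class_zeta_def by (intro suminf_nonneg summable_residue_class_zeta) auto

lemma residue_class_zeta_1_ge: "k > 1 \<Longrightarrow> q > 0 \<Longrightarrow> residue_class_zeta k q 1 \<ge> 1"
  unfolding residue_class_zeta_def
  using sum_le_suminf[OF summable_residue_class_zeta[of k q 1], of "{0}"] by simp

lemma hurwitz_zeta_eq_residue_class_zeta:
  assumes "k > 1" "q > 0" "u > 0"
  shows "hurwitz_zeta (of_nat k) (real u / real q) = of_real (real q ^ k * residue_class_zeta k q u)"
proof -
  have "complex_of_real (real n + real u / real q) powr (- of_nat k)
      = of_real (real q ^ k * (1 / real (n * q + u) ^ k))" for n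
  proof -
    have eq: "real n + real u / real q = real (n * q + u) / real q"
      using assms by (simp add: add_divide_distrib)
    have "complex_of_real (real n + real u / real q) \<noteq> 0"
    proof -
      have "real n + real u / real q > 0" using assms by (intro add_nonneg_pos) auto
      then show ?thesis unfolding of_real_eq_0_iff by linarith
    qed
    then have "complex_of_real (real n + real u / real q) powr (- of_nat k)
        = inverse (complex_of_real (real n + real u / real q) ^ k)"
      by (simp add: powr_minus powr_nat')
    also have "\<dots> = of_real (inverse ((real n + real u / real q) ^ k))" by simp
    also have "inverse ((real n + real u / real q) ^ k) = real q ^ k * (1 / real (n * q + u) ^ k)"
      unfolding eq power_divide by simp
    finally show ?thesis .
  qed
  then have "hurwitz_zeta (of_nat k) (real u / real q) = (\<Sum>n. of_real (real q ^ k * (1 / real (n * q + u) ^ k)))"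
    by (simp add: hurwitz_zeta_def)
  also have "\<dots> = of_real (\<Sum>n. real q ^ k * (1 / real (n * q + u) ^ k))"
    by (intro suminf_of_real[symmetric] summable_mult summable_residue_class_zeta assms)
  also have "(\<Sum>n. real q ^ k * (1 / real (n * q + u) ^ k)) = real q ^ k * residue_class_zeta k q u"
    unfolding residue_class_zeta_def by (intro suminf_mult summable_residue_class_zeta assms)
  finally show ?thesis .
qed

lemma sum_inverse_powers_less_2:
  assumes "k > 1"
  shows "(\<Sum>n. 1 / real (n + 1) ^ k) < 2"
proof -
  have telescope: "1 / (x + 1)\<^sup>2 \<le> 1 / x - 1 / (x + 1)" if "x > 0" for x :: real
  proof -
    have "1 / (x + 1)\<^sup>2 \<le> 1 / (x * (x + 1))"
      using that by (intro divide_left_mono) (auto simp: power2_eq_square intro!: mult_right_mono)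
    also have "\<dots> = 1 / x - 1 / (x + 1)" using that by (simp add: field_simps)
    finally show ?thesis .
  qed
  \<comment> \<open>The first two terms give at most 5/4 and the rest, by telescoping, at most 1/2.
    Telescoping from the very first term would give 2 in the limit, and no strict
    inequality.\<close>
  have bound: "(\<Sum>n<N + 2. 1 / real (n + 1) ^ k) \<le> 7 / 4 - 1 / real (N + 2)" for N
  proof (induction N)
    case 0
    have "(2 :: real) ^ 2 \<le> 2 ^ k" using assms by (intro power_increasing) auto
    then have "1 / (2 :: real) ^ k \<le> 1 / 2 ^ 2" by (intro divide_left_mono) auto
    then show ?case by (simp add: numeral_2_eq_2)
  next
    case (Suc N)
    have "real (N + 3) ^ 2 \<le> real (N + 3) ^ k" using assms by (intro power_increasing) auto
    then have "1 / real (N + 3) ^ k \<le> 1 / real (N + 3) ^ 2" by (intro divide_left_mono) auto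
    also have "\<dots> \<le> 1 / real (N + 2) - 1 / real (N + 3)"
      using telescope[of "real (N + 2)"] by (simp add: add_ac)
    finally show ?case using Suc by (simp add: eval_nat_numeral)
  qed
  have "(\<Sum>n. 1 / real (n + 1) ^ k) \<le> 7 / 4"
  proof (rule suminf_le_const[OF summable_inverse_power_Suc[OF assms]])
    fix n
    have "(\<Sum>i<n. 1 / real (i + 1) ^ k) \<le> (\<Sum>i<n + 2. 1 / real (i + 1) ^ k)"
      by (intro sum_mono2) auto
    also have "\<dots> \<le> 7 / 4 - 1 / real (n + 2)" by (rule bound)
    also have "\<dots> \<le> 7 / 4" by simp
    finally show "(\<Sum>i<n. 1 / real (i + 1) ^ k) \<le> 7 / 4" .
  qed
  then show ?thesis by simp
qed

text \<open>Grouping the terms of \<zeta>(k) into blocks of q consecutive integers meets each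
  residue class once per block.\<close>

lemma sum_residue_class_zeta_less_2:
  assumes "k > 1" "q > 0"
  shows "(\<Sum>u=1..q. residue_class_zeta k q u) < 2"
proof -
  let ?f = "\<lambda>n. 1 / real (n + 1) ^ k"
  have "?f sums (\<Sum>n. ?f n)" using summable_inverse_power_Suc[OF assms(1)] by (rule summable_sums)
  then have "(\<lambda>m. sum ?f {m * q..<m * q + q}) sums (\<Sum>n. ?f n)" using assms(2) by (rule sums_group)
  moreover have "sum ?f {m * q..<m * q + q} = (\<Sum>u=1..q. 1 / real (m * q + u) ^ k)" for m
    by (rule sum.reindex_bij_witness[of _ "\<lambda>u. m * q + u - 1" "\<lambda>n. n + 1 - m * q"]) auto
  ultimately have "(\<lambda>m. \<Sum>u=1..q. 1 / real (m * q + u) ^ k) sums (\<Sum>n. ?f n)" by simp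
  moreover have "(\<lambda>m. \<Sum>u=1..q. 1 / real (m * q + u) ^ k) sums (\<Sum>u=1..q. residue_class_zeta k q u)"
    unfolding residue_class_zeta_def
    by (intro sums_sum summable_sums summable_residue_class_zeta assms) auto
  ultimately have "(\<Sum>u=1..q. residue_class_zeta k q u) = (\<Sum>n. ?f n)" by (metis sums_unique2)
  then show ?thesis using sum_inverse_powers_less_2[OF assms(1)] by simp
qed

text \<open>Diagonal dominance: for a_0 maximising |c_a| take b inverse to a_0 modulo q. In row b
  the entry at a_0 is W(1) \<ge> 1, while the others are values W(u) at distinct u \<noteq> 1 and
  sum to less than 1. This is impossible unless the maximum is 0.\<close>

lemma residue_class_zeta_matrix_injective:
  fixes c :: "nat \<Rightarrow> complex"
  assumes k: "k > 1" and q: "q > 1"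
    and zero: "\<And>b. b \<in> totatives q \<Longrightarrow> (\<Sum>a\<in>totatives q. c a * of_real (residue_class_zeta k q (a * b mod q))) = 0"
    and a: "a \<in> totatives q"
  shows "c a = 0"
proof -
  let ?W = "residue_class_zeta k q"
  define M where "M = Max ((\<lambda>a. norm (c a)) ` totatives q)"
  have fin: "finite (totatives q)" by simp
  have "M \<in> (\<lambda>a. norm (c a)) ` totatives q" unfolding M_def using a fin q by (intro Max_in) auto
  then obtain a0 where a0: "a0 \<in> totatives q" "M = norm (c a0)" by blast
  have le_M: "norm (c a) \<le> M" if "a \<in> totatives q" for a
    unfolding M_def using that fin by (intro Max_ge) auto
  have mem: "x \<in> totatives q \<longleftrightarrow> 0 < x \<and> x < q \<and> coprime x q" for x
    using q by (cases "x = q") (auto simp: totatives_def)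
  have "coprime a0 q" using a0 by (simp add: mem)
  then obtain b' where "[a0 * b' = 1] (mod q)" using cong_solve_coprime_nat by auto
  define b where "b = b' mod q"
  have b1: "a0 * b mod q = 1" 
    using \<open>[a0 * b' = 1] (mod q)\<close> q by (simp add: b_def cong_def mod_mult_right_eq)
  have "coprime b q"
    unfolding coprime_iff_invertible_nat using b1 q by (intro exI[of _ a0]) (simp add: cong_def mult.commute)
  moreover have "b > 0" using b1 by (intro Nat.gr0I) auto
  moreover have "b < q" using q by (simp add: b_def)
  ultimately have b: "b \<in> totatives q" by (simp add: mem)
  have inj: "inj_on (\<lambda>a. a * b mod q) (totatives q)"
  proof (rule inj_onI)
    fix x y assume xy: "x \<in> totatives q" "y \<in> totatives q" "x * b mod q = y * b mod q"
    then have "[x = y] (mod q)" using \<open>coprime b q\<close> by (simp add: cong_def[symmetric] cong_mult_rcancel_nat)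
    then show "x = y" using xy by (simp add: cong_def mem)
  qed
  have maps: "a * b mod q \<in> totatives q" if "a \<in> totatives q" for a
  proof -
    have "coprime (a * b) q" using that b by (simp add: mem)
    then have "coprime (a * b mod q) q" using q by simp
    moreover from this have "a * b mod q \<noteq> 0" using q by (intro notI) simp
    ultimately show ?thesis using q by (simp add: mem)
  qed
  have W_nonneg: "?W u \<ge> 0" if "u > 0" for u using residue_class_zeta_nonneg[OF k _ that] q by simp
  have "(\<Sum>a\<in>totatives q - {a0}. ?W (a * b mod q)) = (\<Sum>u\<in>(\<lambda>a. a * b mod q) ` (totatives q - {a0}). ?W u)"
    using inj_on_subset[OF inj] by (subst sum.reindex) auto
  also have "\<dots> \<le> (\<Sum>u\<in>{1..q} - {1}. ?W u)"
  proof (rule sum_mono2)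
    show "(\<lambda>a. a * b mod q) ` (totatives q - {a0}) \<subseteq> {1..q} - {1}"
    proof (intro subsetI)
      fix u assume "u \<in> (\<lambda>a. a * b mod q) ` (totatives q - {a0})"
      then obtain x where x: "x \<in> totatives q" "x \<noteq> a0" "u = x * b mod q" by auto
      have "u \<noteq> 1" using inj_onD[OF inj, of x a0] x a0(1) b1 by auto
      then show "u \<in> {1..q} - {1}" using maps[OF x(1)] x(3) by (auto simp: mem)
    qed
  qed (auto intro!: W_nonneg)
  also have "\<dots> = (\<Sum>u=1..q. ?W u) - ?W 1" using q by (subst sum_diff1) auto
  also have "\<dots> < 1" using sum_residue_class_zeta_less_2[OF k, of q] residue_class_zeta_1_ge[OF k, of q] q by simp
  finally have small: "(\<Sum>a\<in>totatives q - {a0}. ?W (a * b mod q)) < 1" .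
  have "c a0 * of_real (?W 1) + (\<Sum>a\<in>totatives q - {a0}. c a * of_real (?W (a * b mod q))) = 0"
    using zero[OF b] sum.remove[OF fin a0(1), of "\<lambda>a. c a * of_real (?W (a * b mod q))"] by (simp only: b1)
  then have "c a0 * of_real (?W 1) = - (\<Sum>a\<in>totatives q - {a0}. c a * of_real (?W (a * b mod q)))"
    by (simp only: eq_neg_iff_add_eq_0)
  then have "norm (c a0 * of_real (?W 1)) = norm (\<Sum>a\<in>totatives q - {a0}. c a * of_real (?W (a * b mod q)))"
    by (simp only: norm_minus_cancel)
  also have "\<dots> \<le> (\<Sum>a\<in>totatives q - {a0}. M * ?W (a * b mod q))"
  proof (rule sum_norm_le)
    fix x assume x: "x \<in> totatives q - {a0}"
    then have "?W (x * b mod q) \<ge> 0" using maps[of x] by (intro W_nonneg) (auto simp: mem)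
    then show "norm (c x * of_real (?W (x * b mod q))) \<le> M * ?W (x * b mod q)"
      using le_M[of x] x by (simp add: norm_mult mult_right_mono)
  qed
  also have "\<dots> = M * (\<Sum>a\<in>totatives q - {a0}. ?W (a * b mod q))" by (simp add: sum_distrib_left)
  finally have "M * ?W 1 \<le> M * (\<Sum>a\<in>totatives q - {a0}. ?W (a * b mod q))"
    using W_nonneg[of 1] by (simp add: norm_mult a0(2))
  moreover have "M * (\<Sum>a\<in>totatives q - {a0}. ?W (a * b mod q)) < M * ?W 1" if "M > 0"
    using that small residue_class_zeta_1_ge[OF k, of q] q by (intro mult_strict_left_mono) auto
  ultimately have "\<not> M > 0" by linarith
  then have "norm (c a) \<le> 0" using le_M[OF a] by linarith
  then show ?thesis by simp
qed

subsection \<open>Linear independence\<close>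

lemma algebraic_if_ring_algebraic:
  assumes "ring.algebraic complex_field \<rat> x"
  shows "algebraic x"
proof -
  interpret field complex_field by (rule field_from_type_algebra)
  interpret Q: complex_subfield \<rat> by (rule complex_subfield_Rats)
  have sub: "subring \<rat> complex_field" using Q.subfield by (rule subfieldE)
  obtain p where p: "p \<in> carrier (univ_poly complex_field \<rat>)" "p \<noteq> []" "ring.eval complex_field p x = 0"
    using algebraicE[OF sub, of x] assms by (auto simp: over_def)
  have pow: "x [^]\<^bsub>complex_field\<^esub> n = x ^ n" for n :: nat
    by (induction n) auto
  \<comment> \<open>Here polynomials are lists that start with the leading coefficient, whereas
    \<open>Poly\<close> reads the constant term first; hence \<open>rev\<close>.\<close>
  have eval_eq: "ring.eval complex_field r x = poly (Poly (rev r)) x" for r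
    by (induction r) (auto simp: pow Poly_append poly_monom)
  have p': "hd p \<noteq> 0" "set p \<subseteq> \<rat>"
    using p(1,2) by (auto simp: univ_poly_carrier[symmetric] polynomial_def)
  show ?thesis
  proof (rule algebraicI')
    show "Polynomial.coeff (Poly (rev p)) i \<in> \<rat>" for i
      using p'(2) nth_mem[of i "rev p"] by (auto simp: nth_default_def)
    have lead: "Polynomial.coeff (Poly (rev p)) (length p - 1) = hd p"
      using p(2) by (simp add: nth_default_def rev_nth hd_conv_nth)
    show "Poly (rev p) \<noteq> 0"
    proof
      assume zero: "Poly (rev p) = 0"
      show False using p'(1) lead unfolding zero by simp
    qed
    show "poly (Poly (rev p)) x = 0" using p(3) by (simp add: eval_eq)
  qed
qed

text \<open>X^q and 1 take the same value at z, so evaluation at z is not injective.\<close>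

lemma root_of_unity_ring_algebraic:
  assumes "z ^ q = 1" "q > 0"
  shows "ring.algebraic complex_field \<rat> z"
proof -
  interpret field complex_field by (rule field_from_type_algebra)
  interpret Q: complex_subfield \<rat> by (rule complex_subfield_Rats)
  have sub: "subring \<rat> complex_field" using Q.subfield by (rule subfieldE)
  have pow: "x [^]\<^bsub>complex_field\<^esub> n = x ^ n" for x and n :: nat
    by (induction n) auto
  let ?p = "\<lambda>n. ring.monom complex_field 1 n"
  have carr: "?p n \<in> carrier (univ_poly complex_field \<rat>)" for n
    using monom_is_polynomial[OF sub, of 1 n] by (simp add: univ_poly_carrier)
  have ev: "ring.eval complex_field (?p n) z = z ^ n" for n
    using eval_monom[of 1 z n] by (simp add: pow)
  have "?p q \<noteq> ?p 0" using assms(2) by (auto simp: monom_def)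
  then have "\<not> inj_on (\<lambda>p. ring.eval complex_field p z) (carrier (univ_poly complex_field \<rat>))"
    using carr ev assms(1) by (auto dest: inj_onD[of _ _ "?p q" "?p 0"])
  then show ?thesis by (simp add: transcendental_def)
qed

text \<open>If p has root (2 \<pi> i)^k, then p(2^k X^k) has root \<pi> i; it is nonzero because k >
  0.\<close>

lemma algebraic_power_imp_algebraic:
  assumes "algebraic ((2 * of_real pi * \<i>) ^ k)" "k > 0"
  shows "algebraic (\<i> * of_real pi)"
proof -
  obtain p where p: "\<And>i. coeff p i \<in> \<int>" "p \<noteq> 0" "poly p ((2 * of_real pi * \<i>) ^ k) = 0"
    using assms(1) unfolding algebraic_def by blast
  let ?m = "monom (2 ^ k) k :: complex poly"
  show ?thesis
  proof (rule algebraicI)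
    show "coeff (pcompose p ?m) i \<in> \<int>" for i
      using p(1) by (intro coeff_pcompose_semiring_closed) auto
    have "degree ?m = k" by (simp add: degree_monom_eq)
    then show "pcompose p ?m \<noteq> 0"
      using p(2) assms(2) by (auto simp: pcompose_eq_0_iff)
    show "poly (pcompose p ?m) (\<i> * of_real pi) = 0"
      using p(3) by (simp add: poly_pcompose poly_monom power_mult_distrib mult_ac)
  qed
qed

text \<open>Passes from coefficient lists to sums indexed by the list elements.
  \<open>combine\<close> stops at the shorter list, so missing coefficients count as 0, and
  \<open>take\<close> disregards surplus ones.\<close>

lemma combine_map_eq_sum:
  assumes "distinct as" "set ks \<subseteq> K" "0 \<in> K"
  shows "\<exists>c. (\<forall>a. c a \<in> K) \<and> ring.combine complex_field ks (map f as) = (\<Sum>a\<in>set as. c a * f a)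
     \<and> ((\<forall>a\<in>set as. c a = 0) \<longrightarrow> set (take (length as) ks) \<subseteq> {0})"
  using assms
proof (induction as arbitrary: ks)
  case Nil
  interpret field complex_field by (rule field_from_type_algebra)
  show ?case using Nil.prems by (intro exI[of _ "\<lambda>_. 0"]) (cases ks; simp)
next
  case (Cons a as)
  interpret field complex_field by (rule field_from_type_algebra)
  show ?case
  proof (cases ks)
    case Nil
    then show ?thesis using Cons.prems by (intro exI[of _ "\<lambda>_. 0"]) simp
  next
    case ks: (Cons x ks')
    obtain c where c: "\<forall>a. c a \<in> K" "combine ks' (map f as) = (\<Sum>a\<in>set as. c a * f a)"
      "(\<forall>a\<in>set as. c a = 0) \<longrightarrow> set (take (length as) ks') \<subseteq> {0}"
      using Cons.IH[of ks'] Cons.prems ks by auto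
    have "(\<Sum>b\<in>set as. (c(a := x)) b * f b) = (\<Sum>b\<in>set as. c b * f b)"
      using Cons.prems by (intro sum.cong) auto
    then show ?thesis using c Cons.prems ks
      by (intro exI[of _ "c(a := x)"]) auto
  qed
qed

section \<open>The reflection of a to q - a on reduced residues\<close>

lemma totatives_reflect:
  assumes "q > 2"
  shows "a \<in> totatives q \<Longrightarrow> q - a \<in> totatives q" "a \<in> totatives q \<Longrightarrow> 2 * a \<noteq> q" "a \<in> totatives q \<Longrightarrow> 0 < a \<and> a < q"
proof -
  assume a: "a \<in> totatives q"
  show lt: "0 < a \<and> a < q"
    using a assms by (cases "a = q") (auto simp: totatives_def)
  have cop: "coprime a q" using a by (simp add: totatives_def)
  have "coprime (q - a) q"
    using cop lt by (metis gcd_diff2_nat coprime_iff_gcd_eq_1 less_imp_le)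
  then show "q - a \<in> totatives q" using lt by (auto simp: totatives_def)
  show "2 * a \<noteq> q"
  proof
    assume "2 * a = q"
    then have "a dvd q" by auto
    then have "a = 1" using cop by (simp add: coprime_absorb_left)
    then show False using \<open>2 * a = q\<close> assms by simp
  qed
qed

text \<open>The two residues add up to a multiple of q that lies strictly between 0 and 2 q.\<close>

lemma reflect_mult_mod:
  fixes a b q :: nat
  assumes "a < q" "a * b mod q \<noteq> 0"
  shows "(q - a) * b mod q = q - a * b mod q"
proof -
  have "(q - a) * b + a * b = q * b" using assms(1) by (simp flip: add_mult_distrib)
  then have "((q - a) * b mod q + a * b mod q) mod q = 0" by (simp add: mod_add_eq)
  then obtain m where m: "(q - a) * b mod q + a * b mod q = q * m" by (auto elim: dvdE)
  have q: "q > 0" using assms(1) by simp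
  have "q * m < q * 2" using mod_less_divisor[OF q, of "(q - a) * b"] mod_less_divisor[OF q, of "a * b"] m by linarith
  then have "m < 2" using q by simp
  moreover have "m \<noteq> 0" using m assms(2) by (intro notI) simp
  ultimately have "m = 1" by simp
  then show ?thesis using m by simp
qed

text \<open>The reflection exchanges the totatives below and above q/2, and none equals q/2.\<close>

lemma card_half_totatives:
  assumes "q > 2"
  shows "2 * card {a \<in> totatives q. 2 * a < q} = totient q"
proof -
  let ?S = "{a \<in> totatives q. 2 * a < q}" and ?T = "{a \<in> totatives q. q < 2 * a}"
  note t = totatives_reflect[OF assms]
  have "bij_betw (\<lambda>a. q - a) ?S ?T"
    by (rule bij_betw_byWitness[where f' = "\<lambda>a. q - a"]) (use t in force)+
  then have "card ?T = card ?S" by (simp add: bij_betw_same_card)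
  moreover have "totatives q = ?S \<union> ?T" using t(2) by force
  then have "card (totatives q) = card ?S + card ?T" by (subst card_Un_disjoint[symmetric]) auto
  ultimately show ?thesis by (simp add: totient_def)
qed

text \<open>Conjugation replaces \<zeta>_q by \<zeta>_q^b in the relation. Read backwards, the
  reflection formula turns every conjugate into an equation between real values of
  \<open>residue_class_zeta\<close>; over all b these form the square system already shown to be
  injective.\<close>

lemma hurwitz_relation_trivial:
  fixes c :: "nat \<Rightarrow> complex"
  assumes k: "k > 1" and q: "q > 2"
    and K: "complex_subfield K" "K \<inter> cyclotomic_field q = \<rat>" and c: "\<And>a. c a \<in> K"
    and zero: "(\<Sum>a\<in>{a \<in> totatives q. 2 * a < q}. c a * poly (cot_value_poly k q) (zeta q ^ a)) = 0"
    and a: "a \<in> totatives q" "2 * a < q"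
  shows "c a = 0"
proof -
  interpret K: complex_subfield K by fact
  note t = totatives_reflect[OF q]
  let ?S = "{a \<in> totatives q. 2 * a < q}" and ?T = "{a \<in> totatives q. q < 2 * a}"
  let ?W = "residue_class_zeta k q" and ?g = "cot_value_poly k q"
  \<comment> \<open>The relation says that \<open>h\<close>, a polynomial over K, vanishes at
    \<zeta>_q; in this form conjugation applies.\<close>
  define h where "h = (\<Sum>a\<in>?S. Polynomial.smult (c a) (pcompose ?g (monom 1 a)))"
  have poly_h: "poly h z = (\<Sum>a\<in>?S. c a * poly ?g (z ^ a))" for z
    by (simp add: h_def poly_sum poly_pcompose poly_monom)
  have "coeff (pcompose ?g (monom 1 a)) i \<in> \<rat>" for a i
    by (intro coeff_pcompose_semiring_closed) (auto simp: cot_value_poly_rational)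
  then have "coeff h i \<in> K" for i
    using c K.Rats_subset unfolding h_def coeff_sum coeff_smult by (intro K.sum_mem K.mult_mem) blast+
  moreover have "poly h (zeta q) = 0" using zero by (simp add: poly_h)
  ultimately have conj: "poly h (zeta q ^ b) = 0" if "coprime b q" for b
    using cyclotomic_conjugation[OF _ K _ _ that, of h] q by simp
  \<comment> \<open>Extends \<open>c\<close> to the upper half with the sign (-1)^k of the reflected
    zeta value, so that the sum over pairs a, q - a becomes one sum over all totatives.\<close>
  define C where "C a = (if 2 * a < q then c a else (-1) ^ k * c (q - a))" for a
  have "(\<Sum>a\<in>totatives q. C a * of_real (?W (a * b mod q))) = 0" if b: "b \<in> totatives q" for b
  proof -
    have cop: "coprime b q" using b by (simp add: totatives_def)
    have r: "0 < a * b mod q \<and> a * b mod q < q" if "a \<in> totatives q" for a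
    proof -
      have "coprime (a * b mod q) q" using that cop q by (simp add: totatives_def)
      then have "a * b mod q \<noteq> 0" using q by (intro notI) simp
      then show ?thesis using q by simp
    qed
    have eval_eq: "(2 * of_real pi * \<i>) ^ k * poly ?g ((zeta q ^ b) ^ a)
        = of_real (real q ^ k) * (of_real (?W (a * b mod q)) + (-1) ^ k * of_real (?W ((q - a) * b mod q)))"
      if a: "a \<in> totatives q" for a
    proof -
      define u where "u = a * b mod q"
      have u: "0 < u" "u < q" using r[OF a] by (simp_all add: u_def)
      have "(zeta q ^ b) ^ a = zeta q ^ (a * b)" by (simp add: power_mult[symmetric] mult.commute)
      also have "\<dots> = zeta q ^ (q * (a * b div q) + u)" by (simp add: u_def)
      also have "\<dots> = zeta q ^ u" using zeta_power_eq_1[of q] q by (simp add: power_add power_mult)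
      finally have "(2 * of_real pi * \<i>) ^ k * poly ?g ((zeta q ^ b) ^ a)
          = hurwitz_zeta (of_nat k) (real u / real q) + (-1) ^ k * hurwitz_zeta (of_nat k) (real (q - u) / real q)"
        using hurwitz_zeta_reflection[OF k u] by simp
      also have "\<dots> = of_real (real q ^ k * ?W u) + (-1) ^ k * of_real (real q ^ k * ?W (q - u))"
        using hurwitz_zeta_eq_residue_class_zeta[OF k, of q u] hurwitz_zeta_eq_residue_class_zeta[OF k, of q "q - u"] u
        by simp
      also have "q - u = (q - a) * b mod q"
        using reflect_mult_mod[of a q b] t(3)[OF a] u by (simp add: u_def)
      finally show ?thesis by (simp add: u_def algebra_simps)
    qed
    have "0 = (2 * of_real pi * \<i>) ^ k * poly h (zeta q ^ b)" using conj[OF cop] by simp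
    also have "\<dots> = (\<Sum>a\<in>?S. c a * ((2 * of_real pi * \<i>) ^ k * poly ?g ((zeta q ^ b) ^ a)))"
      by (simp add: poly_h sum_distrib_left mult_ac)
    also have "\<dots> = (\<Sum>a\<in>?S. of_real (real q ^ k) *
        (c a * of_real (?W (a * b mod q)) + (-1) ^ k * c a * of_real (?W ((q - a) * b mod q))))"
    proof (intro sum.cong refl)
      fix a assume "a \<in> ?S"
      then have "a \<in> totatives q" by simp
      then show "c a * ((2 * of_real pi * \<i>) ^ k * poly ?g ((zeta q ^ b) ^ a)) = of_real (real q ^ k) *
          (c a * of_real (?W (a * b mod q)) + (-1) ^ k * c a * of_real (?W ((q - a) * b mod q)))"
        unfolding eval_eq[OF \<open>a \<in> totatives q\<close>] by (simp only: ring_distribs mult_ac)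
    qed
    also have "\<dots> = of_real (real q ^ k) *
        ((\<Sum>a\<in>?S. c a * of_real (?W (a * b mod q))) + (\<Sum>a\<in>?S. (-1) ^ k * c a * of_real (?W ((q - a) * b mod q))))"
      by (simp only: sum_distrib_left[symmetric] sum.distrib)
    finally have "(\<Sum>a\<in>?S. c a * of_real (?W (a * b mod q)))
        + (\<Sum>a\<in>?S. (-1) ^ k * c a * of_real (?W ((q - a) * b mod q))) = 0"
      using q by simp
    also have "(\<Sum>a\<in>?S. c a * of_real (?W (a * b mod q))) = (\<Sum>a\<in>?S. C a * of_real (?W (a * b mod q)))"
      by (intro sum.cong) (auto simp: C_def)
    also have "(\<Sum>a\<in>?S. (-1) ^ k * c a * of_real (?W ((q - a) * b mod q))) = (\<Sum>a\<in>?T. C a * of_real (?W (a * b mod q)))"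
      by (rule sum.reindex_bij_witness[where i = "\<lambda>a. q - a" and j = "\<lambda>a. q - a"])
         (use t in \<open>force simp: C_def\<close>)+
    also have "(\<Sum>a\<in>?S. C a * of_real (?W (a * b mod q))) + (\<Sum>a\<in>?T. C a * of_real (?W (a * b mod q)))
        = (\<Sum>a\<in>?S \<union> ?T. C a * of_real (?W (a * b mod q)))"
      by (intro sum.union_disjoint[symmetric]) auto
    also have "?S \<union> ?T = totatives q" using t(2) by force
    finally show ?thesis .
  qed
  then have "C a = 0"
    using residue_class_zeta_matrix_injective[OF k _ _ a(1), of C] q by simp
  then show ?thesis using a(2) by (simp add: C_def)
qed

theorem theorem3p3:
  fixes k q :: nat and K :: "complex set"
  assumes "k > 1" and "q > 2"
    and "number_field K"
    and "K \<inter> cyclotomic_field q = \<rat>"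
  shows "real (ring.dim complex_field K (V_hat k q K)) \<ge> real (totient q) / 2 + 1"
proof -
  interpret field complex_field by (rule field_from_type_algebra)
  interpret Q: complex_subfield \<rat> by (rule complex_subfield_Rats)
  have K: "subfield K complex_field" "finite_dimension \<rat> K"
    using assms(3) by (auto simp: number_field_def)
  interpret K: complex_subfield K by (rule complex_subfield.intro) fact
  define as where "as = sorted_list_of_set {a \<in> totatives q. 2 * a < q}"
  have as: "set as = {a \<in> totatives q. 2 * a < q}" "distinct as"
    by (simp_all add: as_def)
  define Z where "Z = (\<lambda>a. hurwitz_zeta (of_nat k) (real a / real q))"
  \<comment> \<open>For a below q/2 these are \<phi>(q)/2 elements of the span; together with 1 they
    will be shown independent.\<close>
  define f where "f a = Z a + (-1) ^ k * Z (q - a)" for a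
  define gens where "gens = 1 # map Z (filter (\<lambda>a. coprime a q) [1..<q])"
  have V: "V_hat k q K = Span K gens" unfolding V_hat_def gens_def Z_def ..
  note t = totatives_reflect[OF assms(2)]
  have incl: "set gens \<subseteq> Span K gens" by (rule Span_base_incl[OF K(1)]) simp
  have Z_mem: "Z a \<in> Span K gens" if "a \<in> totatives q" for a
  proof -
    have "Z a \<in> set gens" using that t(3)[OF that] by (auto simp: gens_def totatives_def)
    then show ?thesis using incl by blast
  qed
  have f_mem: "f a \<in> Span K gens" if "a \<in> totatives q" for a
  proof -
    have "(-1) ^ k * Z (q - a) \<in> Span K gens"
      using Span_smult_closed[OF K(1), of gens "(-1) ^ k" "Z (q - a)"] Z_mem[OF t(1)[OF that]] by simp
    then show ?thesis
      using Span_subgroup_props(3)[OF K(1), of gens "Z a" "(-1) ^ k * Z (q - a)"] Z_mem[OF that]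
      by (simp add: f_def)
  qed
  have f_eq: "f a = (2 * of_real pi * \<i>) ^ k * poly (cot_value_poly k q) (zeta q ^ a)" if "a \<in> totatives q" for a
    unfolding f_def Z_def using t(3)[OF that] by (intro hurwitz_zeta_reflection assms) auto
  \<comment> \<open>The algebraic numbers form a field containing \<zeta>_q and K, as K is finite
    over \<rat>. Hence the coefficients of a relation over K, and \<beta> below, are
    algebraic.\<close>
  interpret A: complex_subfield "{x. algebraic \<rat> x}"
    using subfield_of_algebraics[OF Q.subfield] by (intro complex_subfield.intro) (simp add: over_def)
  have K_alg: "x \<in> {x. algebraic \<rat> x}" if "x \<in> K" for x
    using finite_dimension_imp_algebraic[OF Q.subfield subfieldE(1)[OF K(1)], of x] K(2) that by (simp add: over_def)
  have zeta_alg: "zeta q \<in> {x. algebraic \<rat> x}"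
    using root_of_unity_ring_algebraic[OF zeta_power_eq_1] assms(2) by simp
  have indep: "independent K (1 # map f as)"
  proof (rule trivial_combine_imp_independent[OF K(1)])
    fix ks assume ks: "set ks \<subseteq> K" "combine ks (1 # map f as) = \<zero>\<^bsub>complex_field\<^esub>"
    show "set (take (length (1 # map f as)) ks) \<subseteq> {\<zero>\<^bsub>complex_field\<^esub>}"
    proof (cases ks)
      case (Cons x ks')
      obtain c where c: "\<And>a. c a \<in> K" "combine ks' (map f as) = (\<Sum>a\<in>set as. c a * f a)"
        "(\<forall>a\<in>set as. c a = 0) \<longrightarrow> set (take (length as) ks') \<subseteq> {0}"
        using combine_map_eq_sum[OF as(2), of ks' K f] ks(1) Cons by auto
      define \<beta> where "\<beta> = (\<Sum>a\<in>set as. c a * poly (cot_value_poly k q) (zeta q ^ a))"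
      have "combine ks' (map f as) = (2 * of_real pi * \<i>) ^ k * \<beta>"
        unfolding c(2) \<beta>_def sum_distrib_left using as(1)
        by (intro sum.cong refl) (simp add: f_eq mult_ac)
      then have rel: "x + (2 * of_real pi * \<i>) ^ k * \<beta> = 0" using ks(2) Cons by simp
      have "\<beta> \<in> {x. algebraic \<rat> x}"
        unfolding \<beta>_def poly_altdef
        using c(1) K_alg zeta_alg A.Rats_subset cot_value_poly_rational
        by (intro A.sum_mem A.mult_mem A.power_mem) blast+
      moreover have "x \<in> {x. algebraic \<rat> x}" using K_alg ks(1) Cons by simp
      \<comment> \<open>If \<beta> \<noteq> 0, the relation writes (2 \<pi> i)^k as the algebraic
        number -x/\<beta>, which would make \<pi> i algebraic.\<close>
      ultimately have "- x / \<beta> \<in> {x. algebraic \<rat> x}" by (intro A.divide_mem A.uminus_mem)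
      moreover have "(2 * of_real pi * \<i>) ^ k = - x / \<beta>" if "\<beta> \<noteq> 0"
        using rel that by (simp add: field_simps eq_neg_iff_add_eq_0)
      ultimately have "\<beta> = 0"
        using algebraic_if_ring_algebraic[of "(2 * of_real pi * \<i>) ^ k"] algebraic_power_imp_algebraic[of k]
          pi_times_i_not_algebraic assms(1) by force
      then have "c a = 0" if "a \<in> set as" for a
        using hurwitz_relation_trivial[OF assms(1,2) K.complex_subfield_axioms assms(4), of c a] c(1) that as(1)
        by (simp add: \<beta>_def)
      moreover have "x = 0" using rel \<open>\<beta> = 0\<close> by simp
      ultimately show ?thesis using c(3) Cons by simp
    qed simp
  qed simp
  \<comment> \<open>An independent list with the same span shows that the dimension is finite and
    equals its length; no independent list inside the space can then be longer.\<close>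
  obtain Vs where Vs: "independent K Vs" "Span K Vs = Span K gens"
    using filter_base[OF K(1), of gens] by auto
  have dim: "dimension (length Vs) K (V_hat k q K)"
    unfolding V using dimension_independent[OF Vs(1)] Vs(2) by simp
  have "length (1 # map f as) \<le> length Vs"
  proof (rule independent_length_le_dimension[OF K(1) dim indep])
    show "set (1 # map f as) \<subseteq> V_hat k q K"
      unfolding V using incl f_mem as(1) by (auto simp: gens_def)
  qed
  also have "length Vs = ring.dim complex_field K (V_hat k q K)"
    using dimI[OF K(1) dim] by (simp add: over_def)
  finally have "1 + card {a \<in> totatives q. 2 * a < q} \<le> ring.dim complex_field K (V_hat k q K)"
    using as by (simp flip: distinct_card)
  then show ?thesis using card_half_totatives[OF assms(2)] by linarith
qed

end
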